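(* Let $n,m\ge1$ be integers, $1<p_i<\infty$ for $i=1,\dots,m$, $\frac1p=\sum_{i=1}^m\frac1{p_i}$, and $\frac1m<p\le q<\infty$. Let $\varphi:(0,\infty)\to(0,\infty)$ be essentially nondecreasing with $\lim_{t\to\infty}\varphi(t)/t=0$. Let $Y_1,\dots,Y_m$ be Banach function spaces over $\mathbb{R}^n$ such that, for each $i$, $M_{Y_i'}$ is bounded from $L^{p_i}(\mathbb{R}^n)$ to $L^{p_i}(\mathbb{R}^n)$. Suppose that $\nu,w_1,\dots,w_m$ are weights on $\mathbb{R}^n$ such that, for some positive constant $C$ and every cube $Q$, $$\varphi(|Q|)\,|Q|^{1/q-1/p}\left(\frac1{|Q|}\int_Q\nu^q\right)^{1/q}\prod_{i=1}^m\|w_i^{-1}\|_{Y_i,Q}\le C.$$ Then there is a constant $C>0$ such that $$\|\mathcal{M}_\varphi\vec f\;\nu\|_{L^q}\le C\prod_{i=1}^m\|f_iw_i\|_{L^{p_i}}$$ for every $\vec f=(f_1,\dots,f_m)\in L^{p_1}(w_1^{p_1})\times\dots\times L^{p_m}(w_m^{p_m})$.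
   Context: A weight is a nonnegative measurable function on $\mathbb{R}^n$; the $w_i$ are understood to be positive a.e., since $w_i^{-1}$ occurs. Cubes have sides parallel to the axes. $\varphi$ is essentially nondecreasing if there is $\rho>0$ with $\varphi(t)\le\rho\varphi(s)$ whenever $t\le s$. The multilinear maximal operator associated to $\varphi$ is $\mathcal{M}_\varphi\vec f(x)=\sup_{Q\ni x}\varphi(|Q|)\prod_{i=1}^m\frac1{|Q|}\int_Q|f_i|$, over all cubes $Q\ni x$. Banach function spaces $X$ over $\mathbb{R}^n$ (with Lebesgue measure) are in the sense of Bennett–Sharpley; $X'$ denotes the associate space, for which $\int|fg|\le\|f\|_X\|g\|_{X'}$. For a cube $Q$ with side length $l(Q)$, the $X$-average is $\|f\|_{X,Q}=\|\delta_{l(Q)}(f\chi_Q)\|_X$, where $\delta_af(x)=f(ax)$ for $a>0$; and $M_Xf(x)=\sup_{Q\ni x}\|f\|_{X,Q}$. $L^p(v)$ is the $L^p$ space with respect to $v(x)\,dx$. *)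

theory Defs
  imports "HOL-Analysis.Analysis"
begin

(* Real powers of elements of [0,\<infinity>]; only used with a > 0. *)
definition ennreal_powr :: "ennreal \<Rightarrow> real \<Rightarrow> ennreal" where
  "ennreal_powr x a = (if x = \<infinity> then \<infinity> else ennreal (enn2real x powr a))"

definition Lp_norm :: "real \<Rightarrow> (real^'n \<Rightarrow> ennreal) \<Rightarrow> ennreal" where
  "Lp_norm p g = ennreal_powr (\<integral>\<^sup>+x. ennreal_powr (g x) p \<partial>lebesgue) (1 / p)"

definition Lp_space :: "real \<Rightarrow> (real^'n \<Rightarrow> real) \<Rightarrow> (real^'n \<Rightarrow> real) set" where
  "Lp_space p v = {f \<in> borel_measurable lebesgue.
     (\<integral>\<^sup>+x. ennreal (\<bar>f x\<bar> powr p * v x) \<partial>lebesgue) < \<infinity>}"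

definition weight :: "(real^'n \<Rightarrow> real) \<Rightarrow> bool" where
  "weight v \<longleftrightarrow> v \<in> borel_measurable lebesgue \<and> (\<forall>x. 0 \<le> v x)"

definition essentially_nondecreasing :: "(real \<Rightarrow> real) \<Rightarrow> bool" where
  "essentially_nondecreasing \<phi> \<longleftrightarrow>
     (\<exists>r>0. \<forall>t s. 0 < t \<longrightarrow> t \<le> s \<longrightarrow> \<phi> t \<le> r * \<phi> s)"

(* The closed cube with lower-left corner a and side length l; it is a cube only for l > 0.
   Cubes are carried around as pairs (a, l), so that the side length is at hand. *)
definition cube :: "real^'n \<Rightarrow> real \<Rightarrow> (real^'n) set" where
  "cube a l = cbox a (a + vec l)"

definition multilinear_maximal ::
    "(real \<Rightarrow> real) \<Rightarrow> nat \<Rightarrow> (nat \<Rightarrow> real^'n \<Rightarrow> real) \<Rightarrow> real^'n \<Rightarrow> ennreal" where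
  "multilinear_maximal \<phi> m f x =
     (SUP (a, l) \<in> {(a, l). 0 < l \<and> x \<in> cube a l}.
        ennreal (\<phi> (measure lebesgue (cube a l))) *
        (\<Prod>i=1..m. ennreal (1 / measure lebesgue (cube a l)) *
                   (\<integral>\<^sup>+y\<in>cube a l. ennreal \<bar>f i y\<bar> \<partial>lebesgue)))"

(* Banach function norms in the sense of Bennett and Sharpley. They act on the cone of
   measurable functions with values in [0,\<infinity>]; the value of \<rho> at a nonmeasurable function is
   irrelevant. A Banach function space X is represented by its norm \<rho>: it consists of the
   measurable f with \<rho> |f| < \<infinity>. *)
locale banach_function_norm =
  fixes \<rho> :: "(real^'n \<Rightarrow> ennreal) \<Rightarrow> ennreal"
  assumes eq_0_iff: "f \<in> borel_measurable lebesgue \<Longrightarrow>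
            \<rho> f = 0 \<longleftrightarrow> (AE x in lebesgue. f x = 0)"
    and homogeneous: "f \<in> borel_measurable lebesgue \<Longrightarrow> 0 \<le> c \<Longrightarrow>
            \<rho> (\<lambda>x. ennreal c * f x) = ennreal c * \<rho> f"
    and triangle: "f \<in> borel_measurable lebesgue \<Longrightarrow> g \<in> borel_measurable lebesgue \<Longrightarrow>
            \<rho> (\<lambda>x. f x + g x) \<le> \<rho> f + \<rho> g"
    and lattice: "f \<in> borel_measurable lebesgue \<Longrightarrow> g \<in> borel_measurable lebesgue \<Longrightarrow>
            (AE x in lebesgue. g x \<le> f x) \<Longrightarrow> \<rho> g \<le> \<rho> f"
    and Fatou: "(\<And>k::nat. F k \<in> borel_measurable lebesgue) \<Longrightarrow> f \<in> borel_measurable lebesgue \<Longrightarrow>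
            (AE x in lebesgue. incseq (\<lambda>k. F k x) \<and> (SUP k. F k x) = f x) \<Longrightarrow>
            (SUP k. \<rho> (F k)) = \<rho> f"
    and indicator_finite: "E \<in> sets lebesgue \<Longrightarrow> emeasure lebesgue E < \<infinity> \<Longrightarrow>
            \<rho> (indicator E) < \<infinity>"
    and local_L1: "E \<in> sets lebesgue \<Longrightarrow> emeasure lebesgue E < \<infinity> \<Longrightarrow>
            \<exists>C::real>0. \<forall>f\<in>borel_measurable lebesgue.
              (\<integral>\<^sup>+x\<in>E. f x \<partial>lebesgue) \<le> ennreal C * \<rho> f"

definition associate_norm ::
    "((real^'n \<Rightarrow> ennreal) \<Rightarrow> ennreal) \<Rightarrow> (real^'n \<Rightarrow> ennreal) \<Rightarrow> ennreal" where
  "associate_norm \<rho> g =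
     (SUP f \<in> {f \<in> borel_measurable lebesgue. \<rho> f \<le> 1}. \<integral>\<^sup>+x. f x * g x \<partial>lebesgue)"

definition bfs_norm :: "((real^'n \<Rightarrow> ennreal) \<Rightarrow> ennreal) \<Rightarrow> (real^'n \<Rightarrow> real) \<Rightarrow> ennreal" where
  "bfs_norm \<rho> f = \<rho> (\<lambda>x. ennreal \<bar>f x\<bar>)"

definition dilation :: "real \<Rightarrow> (real^'n \<Rightarrow> real) \<Rightarrow> real^'n \<Rightarrow> real" where
  "dilation s f x = f (s *\<^sub>R x)"

definition bfs_average ::
    "((real^'n \<Rightarrow> ennreal) \<Rightarrow> ennreal) \<Rightarrow> real^'n \<Rightarrow> real \<Rightarrow> (real^'n \<Rightarrow> real) \<Rightarrow> ennreal" where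
  "bfs_average \<rho> a l f = bfs_norm \<rho> (dilation l (\<lambda>x. f x * indicator (cube a l) x))"

definition bfs_maximal ::
    "((real^'n \<Rightarrow> ennreal) \<Rightarrow> ennreal) \<Rightarrow> (real^'n \<Rightarrow> real) \<Rightarrow> real^'n \<Rightarrow> ennreal" where
  "bfs_maximal \<rho> f x = (SUP (a, l) \<in> {(a, l). 0 < l \<and> x \<in> cube a l}. bfs_average \<rho> a l f)"

definition bounded_on_Lp ::
    "real \<Rightarrow> ((real^'n \<Rightarrow> real) \<Rightarrow> real^'n \<Rightarrow> ennreal) \<Rightarrow> bool" where
  "bounded_on_Lp p T \<longleftrightarrow>
     (\<exists>C::real>0. \<forall>f\<in>Lp_space p (\<lambda>_. 1).
        Lp_norm p (T f) \<le> ennreal C * Lp_norm p (\<lambda>x. ennreal \<bar>f x\<bar>))"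

end

theory Submission
  imports Defs
begin

text \<open>
  Every cube lies in a cube, at most six times as large, of one of finitely many shifted dyadic
  grids (the one-third trick), so \<open>\<M>\<^sub>\<phi>\<close> is dominated pointwise by the dyadic maximal
  functions of these grids. By monotone convergence it suffices to treat a finite family of dyadic
  cubes \<open>Q\<close> with values \<open>\<lambda>\<^sub>Q = \<phi>(|Q|) \<Prod>\<^sub>i |Q|\<^sup>-\<^sup>1 \<integral>\<^sub>Q |f\<^sub>i|\<close>;
  restricting to \<open>\<integral>\<^sub>Q \<nu>\<^sup>q > 0\<close> makes all the averages finite. Keeping only cubes at which \<open>\<lambda>\<close> jumps by a large factor
  gives a principal subfamily. Since \<open>\<phi>\<close> is essentially nondecreasing, at such a jump the average
  of some \<open>f\<^sub>i\<close> jumps, so the principal cubes strictly inside \<open>Q\<close> cover at most half of \<open>Q\<close>. For a principal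
  cube, Hoelder's inequality for \<open>Y\<^sub>i\<close> and the test condition bound \<open>\<lambda>\<^sub>Q\<^sup>q \<integral>\<^sub>Q \<nu>\<^sup>q\<close> by
  \<open>C\<^sup>q \<Prod>\<^sub>i (|Q| c\<^sub>i(Q)\<^sup>p\<^sup>i)\<^sup>q\<^sup>/\<^sup>p\<^sup>i\<close> with \<open>c\<^sub>i(Q)\<close> the \<open>Y\<^sub>i'\<close>-average of \<open>f\<^sub>i w\<^sub>i\<close>. A discrete
  Hoelder inequality and sparseness bound the sum over the principal cubes by the integrals of
  \<open>(M f\<^sub>i w\<^sub>i)\<^sup>p\<^sup>i\<close>, where \<open>M\<close> is the maximal operator of \<open>Y\<^sub>i'\<close>.
\<close>

section \<open>Extended powers and a discrete Hoelder inequality\<close>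

lemma ennreal_powr_ennreal: "0 \<le> r \<Longrightarrow> ennreal_powr (ennreal r) a = ennreal (r powr a)"
  by (simp add: ennreal_powr_def)

lemma ennreal_powr_top [simp]: "ennreal_powr top a = top"
  by (simp add: ennreal_powr_def)

lemma ennreal_powr_0 [simp]: "ennreal_powr 0 a = 0"
  by (simp add: ennreal_powr_def)

lemma ennreal_powr_one [simp]: "ennreal_powr x 1 = x"
  by (cases x) (auto simp: ennreal_powr_ennreal)

lemma ennreal_powr_eq_0_iff [simp]: "ennreal_powr x a = 0 \<longleftrightarrow> x = 0"
  by (cases x) (auto simp: ennreal_powr_ennreal ennreal_eq_0_iff order.antisym)

lemma ennreal_powr_eq_top_iff [simp]: "ennreal_powr x a = top \<longleftrightarrow> x = top"
  by (cases x) (auto simp: ennreal_powr_ennreal)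

lemma ennreal_powr_less_top_iff [simp]: "ennreal_powr x a < top \<longleftrightarrow> x < top"
  by (simp add: less_top[symmetric])

lemma ennreal_powr_mono: "0 \<le> a \<Longrightarrow> x \<le> y \<Longrightarrow> ennreal_powr x a \<le> ennreal_powr y a"
  by (cases x; cases y)
     (auto simp: ennreal_powr_ennreal top_unique intro!: ennreal_leI powr_mono2)

text \<open>Valid for every real \<open>a\<close>: powers fix both 0 and \<open>top\<close>,
  whatever the exponent, so the convention \<open>0 * top = 0\<close> is respected on both
  sides.\<close>

lemma ennreal_powr_mult: "ennreal_powr (x * y) a = ennreal_powr x a * ennreal_powr y a"
proof (cases "x = top \<or> y = top")
  case True
  then show ?thesis by (auto simp: ennreal_mult_top ennreal_top_mult)
next
  case False
  then show ?thesis
    by (cases x; cases y)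
       (auto simp: ennreal_powr_ennreal powr_mult simp flip: ennreal_mult)
qed

lemma ennreal_powr_powr: "ennreal_powr (ennreal_powr x a) b = ennreal_powr x (a * b)"
  by (cases x) (auto simp: ennreal_powr_ennreal powr_powr)

lemma ennreal_powr_prod: "finite I \<Longrightarrow> ennreal_powr (\<Prod>i\<in>I. g i) a = (\<Prod>i\<in>I. ennreal_powr (g i) a)"
  by (induction I rule: finite_induct)
     (auto simp: ennreal_powr_mult ennreal_powr_ennreal simp flip: ennreal_1)

lemma measurable_ennreal_powr [measurable]:
  assumes [measurable]: "g \<in> borel_measurable M"
  shows "(\<lambda>x. ennreal_powr (g x) a) \<in> borel_measurable M"
  unfolding ennreal_powr_def by measurable

lemma ennreal_powr_le_imp:
  assumes "0 < a" "ennreal_powr x a \<le> y" shows "x \<le> ennreal_powr y (1 / a)"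
  using ennreal_powr_mono[of "1 / a" "ennreal_powr x a" y] assms by (simp add: ennreal_powr_powr)

text \<open>Jensen's inequality for \<open>exp\<close> at the points \<open>ln (t i)\<close>.
  Vanishing \<open>t i\<close> are split off first, because the logarithm needs positive
  arguments.\<close>

lemma weighted_geometric_mean_le:
  fixes t \<theta> :: "'i \<Rightarrow> real"
  assumes "finite I" "\<And>i. i \<in> I \<Longrightarrow> 0 \<le> t i" "\<And>i. i \<in> I \<Longrightarrow> 0 \<le> \<theta> i" "(\<Sum>i\<in>I. \<theta> i) = 1"
  shows "(\<Prod>i\<in>I. t i powr \<theta> i) \<le> (\<Sum>i\<in>I. \<theta> i * t i)"
proof (cases "\<exists>i\<in>I. t i = 0")
  case True
  \<comment> \<open>Since \<open>0 powr 0 = 0\<close>, a vanishing \<open>t i\<close> annihilates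
    the product even when its exponent is 0.\<close>
  then have "(\<Prod>i\<in>I. t i powr \<theta> i) = 0" using assms(1) by (intro prod_zero) auto
  moreover have "0 \<le> (\<Sum>i\<in>I. \<theta> i * t i)" using assms by (intro sum_nonneg) auto
  ultimately show ?thesis by (simp only:)
next
  case False
  then have t: "\<And>i. i \<in> I \<Longrightarrow> 0 < t i" using assms(2) by (force simp: order_le_less)
  have "I \<noteq> {}" using assms(4) by auto
  have "(\<Prod>i\<in>I. t i powr \<theta> i) = exp (\<Sum>i\<in>I. \<theta> i *\<^sub>R ln (t i))"
    using t assms(1) by (auto simp: exp_sum powr_def intro!: prod.cong split: if_splits dest: t)
  also have "\<dots> \<le> (\<Sum>i\<in>I. \<theta> i * exp (ln (t i)))"
    using assms \<open>I \<noteq> {}\<close> by (intro convex_on_sum[OF _ _ exp_convex]) auto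
  also have "\<dots> = (\<Sum>i\<in>I. \<theta> i * t i)" using t by (intro sum.cong) auto
  finally show ?thesis .
qed

text \<open>All \<open>t i Q\<close> are at most 1, so dividing the exponents by their sum, which is
  at least 1, only enlarges the product. The new exponents add up to 1, and the weighted geometric
  mean inequality linearises each term.\<close>

lemma sum_prod_powr_le_1:
  fixes t :: "'i \<Rightarrow> 'b \<Rightarrow> real"
  assumes "finite I" "finite G" "\<And>i. i \<in> I \<Longrightarrow> 0 \<le> \<theta> i" "1 \<le> (\<Sum>i\<in>I. \<theta> i)"
    and t: "\<And>i Q. i \<in> I \<Longrightarrow> Q \<in> G \<Longrightarrow> 0 \<le> t i Q" "\<And>i. i \<in> I \<Longrightarrow> (\<Sum>Q\<in>G. t i Q) \<le> 1"
  shows "(\<Sum>Q\<in>G. \<Prod>i\<in>I. t i Q powr \<theta> i) \<le> 1"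
proof -
  define \<Theta> where "\<Theta> = (\<Sum>i\<in>I. \<theta> i)"
  have \<Theta>: "1 \<le> \<Theta>" using assms by (simp add: \<Theta>_def)
  have t1: "t i Q \<le> 1" if "i \<in> I" "Q \<in> G" for i Q
  proof -
    have "t i Q \<le> (\<Sum>Q\<in>G. t i Q)" using that t(1) assms(2) by (intro member_le_sum) auto
    with t(2)[OF that(1)] show ?thesis by simp
  qed
  have "(\<Sum>Q\<in>G. \<Prod>i\<in>I. t i Q powr \<theta> i) \<le> (\<Sum>Q\<in>G. \<Sum>i\<in>I. \<theta> i / \<Theta> * t i Q)"
  proof (rule sum_mono)
    fix Q assume Q: "Q \<in> G"
    have "(\<Prod>i\<in>I. t i Q powr \<theta> i) \<le> (\<Prod>i\<in>I. t i Q powr (\<theta> i / \<Theta>))"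
    proof (intro prod_mono conjI powr_ge_zero powr_mono')
      fix i assume i: "i \<in> I"
      show "\<theta> i / \<Theta> \<le> \<theta> i" using \<Theta> assms(3)[OF i] 
        by (simp add: divide_le_eq mult_left_le[of 1] mult_le_cancel_left1)
    qed (use t t1 Q in auto)
    also have "\<dots> \<le> (\<Sum>i\<in>I. \<theta> i / \<Theta> * t i Q)"
      using assms \<Theta> Q by (intro weighted_geometric_mean_le) (auto simp: \<Theta>_def simp flip: sum_divide_distrib)
    finally show "(\<Prod>i\<in>I. t i Q powr \<theta> i) \<le> (\<Sum>i\<in>I. \<theta> i / \<Theta> * t i Q)" .
  qed
  also have "\<dots> = (\<Sum>i\<in>I. \<theta> i / \<Theta> * (\<Sum>Q\<in>G. t i Q))"
    by (subst sum.swap) (simp add: sum_distrib_left)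
  also have "\<dots> \<le> (\<Sum>i\<in>I. \<theta> i / \<Theta> * 1)"
    using assms \<Theta> by (intro sum_mono mult_left_mono) auto
  also have "\<dots> = 1" using \<Theta> by (simp add: \<Theta>_def flip: sum_divide_distrib)
  finally show ?thesis .
qed

text \<open>Hoelder's inequality combined with the embedding of \<open>\<ell>\<^sup>1\<close> into \<open>\<ell>\<^sup>r\<close> for
  \<open>r = (\<Sum>i. \<theta> i)\<close>.\<close>

lemma sum_prod_ennreal_powr_le:
  fixes b :: "'i \<Rightarrow> 'b \<Rightarrow> ennreal"
  assumes I: "finite I" and G: "finite G" and \<theta>: "\<And>i. i \<in> I \<Longrightarrow> 0 \<le> \<theta> i" "1 \<le> (\<Sum>i\<in>I. \<theta> i)"
  shows "(\<Sum>Q\<in>G. \<Prod>i\<in>I. ennreal_powr (b i Q) (\<theta> i)) \<le> (\<Prod>i\<in>I. ennreal_powr (\<Sum>Q\<in>G. b i Q) (\<theta> i))"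
proof (cases "\<exists>i\<in>I. (\<Sum>Q\<in>G. b i Q) = 0")
  case True
  then obtain i where i: "i \<in> I" "\<And>Q. Q \<in> G \<Longrightarrow> b i Q = 0" using G by auto
  then have "(\<Prod>i\<in>I. ennreal_powr (b i Q) (\<theta> i)) = 0" if "Q \<in> G" for Q
    using I that by (intro prod_zero) auto
  then have "(\<Sum>Q\<in>G. \<Prod>i\<in>I. ennreal_powr (b i Q) (\<theta> i)) = 0"
    by (intro sum.neutral) blast
  then show ?thesis by (simp only: zero_le)
next
  case nz: False
  show ?thesis
  \<comment> \<open>As no factor on the right vanishes, a single infinite sum makes the right side
    infinite. Otherwise all quantities are real.\<close>
  proof (cases "\<exists>i\<in>I. (\<Sum>Q\<in>G. b i Q) = top")
    case True
    then have "(\<Prod>i\<in>I. ennreal_powr (\<Sum>Q\<in>G. b i Q) (\<theta> i)) = top"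
      using nz I by (subst ennreal_prod_eq_top) auto
    then show ?thesis by simp
  next
    case False
    define B where "B i = enn2real (\<Sum>Q\<in>G. b i Q)" for i
    define c where "c i Q = enn2real (b i Q)" for i Q
    have B: "ennreal (B i) = (\<Sum>Q\<in>G. b i Q)" if "i \<in> I" for i
      using False that by (auto simp: B_def less_top)
    have B0: "0 < B i" if "i \<in> I" for i
      using nz False that by (auto simp: B_def enn2real_positive_iff less_top zero_less_iff_neq_zero)
    have c: "ennreal (c i Q) = b i Q" if "i \<in> I" "Q \<in> G" for i Q
      using False that G by (auto simp: c_def less_top[symmetric])
    have c0: "0 \<le> c i Q" for i Q by (simp add: c_def)
    have Bc: "B i = (\<Sum>Q\<in>G. c i Q)" if "i \<in> I" for i
    proof -
      have "(\<Sum>Q\<in>G. b i Q) = (\<Sum>Q\<in>G. ennreal (c i Q))" using c that by simp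
      also have "\<dots> = ennreal (\<Sum>Q\<in>G. c i Q)" using c0 by (rule sum_ennreal)
      finally show ?thesis using c0 by (simp add: B_def sum_nonneg)
    qed
    \<comment> \<open>Both sides have the same homogeneity in each family \<open>b i\<close>, so
      every family may be normalised to total mass at most 1.\<close>
    have "(\<Sum>Q\<in>G. \<Prod>i\<in>I. (c i Q / B i) powr \<theta> i) \<le> 1"
    proof (rule sum_prod_powr_le_1[OF I G \<theta>])
      show "0 \<le> c i Q / B i" if "i \<in> I" for i Q
        using c0 B0[OF that] by simp
      show "(\<Sum>Q\<in>G. c i Q / B i) \<le> 1" if "i \<in> I" for i
        using B0[OF that] Bc[OF that, symmetric] by (simp flip: sum_divide_distrib)
    qed
    also have "(\<Sum>Q\<in>G. \<Prod>i\<in>I. (c i Q / B i) powr \<theta> i)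
        = (\<Sum>Q\<in>G. (\<Prod>i\<in>I. c i Q powr \<theta> i) / (\<Prod>i\<in>I. B i powr \<theta> i))"
      using c0 B0 by (intro sum.cong refl) (simp add: prod_dividef powr_divide order.strict_implies_order cong: prod.cong)
    also have "\<dots> = (\<Sum>Q\<in>G. \<Prod>i\<in>I. c i Q powr \<theta> i) / (\<Prod>i\<in>I. B i powr \<theta> i)"
      by (simp add: sum_divide_distrib)
    finally have *: "(\<Sum>Q\<in>G. \<Prod>i\<in>I. c i Q powr \<theta> i) \<le> (\<Prod>i\<in>I. B i powr \<theta> i)"
    proof (subst (asm) divide_le_eq_1_pos)
      show "0 < (\<Prod>i\<in>I. B i powr \<theta> i)" using B0 by (intro prod_pos) force
    qed
    have "(\<Sum>Q\<in>G. \<Prod>i\<in>I. ennreal_powr (b i Q) (\<theta> i)) = ennreal (\<Sum>Q\<in>G. \<Prod>i\<in>I. c i Q powr \<theta> i)"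
      using c c0 by (auto simp: prod_nonneg ennreal_powr_ennreal simp flip: c sum_ennreal prod_ennreal intro!: sum.cong prod.cong)
    also have "\<dots> \<le> ennreal (\<Prod>i\<in>I. B i powr \<theta> i)" using * by (rule ennreal_leI)
    also have "\<dots> = (\<Prod>i\<in>I. ennreal_powr (\<Sum>Q\<in>G. b i Q) (\<theta> i))"
      using B0 by (auto simp: ennreal_powr_ennreal order.strict_implies_order simp flip: B prod_ennreal intro!: prod.cong)
    finally show ?thesis .
  qed
qed

section \<open>Laminar families\<close>

text \<open>The union is the disjoint union of its maximal members, and on those both measures add
  up. The induction inserts sets by decreasing level, so a new set either lies in an older one or is
  disjoint from all of them.\<close>

lemma emeasure_UN_le_laminar:
  fixes S :: "'b \<Rightarrow> 'a set" and level :: "'b \<Rightarrow> int"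
  assumes "finite F"
    and sets: "sets N = sets M" "\<And>Q. Q \<in> F \<Longrightarrow> S Q \<in> sets M"
    and laminar: "\<And>Q R. Q \<in> F \<Longrightarrow> R \<in> F \<Longrightarrow> level Q \<le> level R \<Longrightarrow> S Q \<inter> S R = {} \<or> S Q \<subseteq> S R"
    and le: "\<And>Q. Q \<in> F \<Longrightarrow> emeasure M (S Q) \<le> emeasure N (S Q)"
  shows "emeasure M (\<Union>Q\<in>F. S Q) \<le> emeasure N (\<Union>Q\<in>F. S Q)"
  using assms
proof (induction F rule: finite_ranking_induct[where f = "\<lambda>Q. - level Q"])
  case empty
  then show ?case by simp
next
  case (insert Q F)
  have IH: "emeasure M (\<Union>Q\<in>F. S Q) \<le> emeasure N (\<Union>Q\<in>F. S Q)"
    using insert.prems by (intro insert.IH) auto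
  have lam: "S Q \<inter> S R = {} \<or> S Q \<subseteq> S R" if "R \<in> F" for R
    using insert.prems(3)[of Q R] insert.hyps(2)[OF that] that by auto
  show ?case
  proof (cases "\<exists>R\<in>F. S Q \<subseteq> S R")
    case True
    then have "(\<Union>Q\<in>insert Q F. S Q) = (\<Union>Q\<in>F. S Q)" by auto
    then show ?thesis using IH by (simp only:)
  next
    case False
    then have disj: "S Q \<inter> (\<Union>Q\<in>F. S Q) = {}" using lam by blast
    have m: "S Q \<in> sets M" "(\<Union>Q\<in>F. S Q) \<in> sets M"
      using insert.prems(2) insert.hyps(1) by auto
    have "emeasure M (S Q \<union> (\<Union>Q\<in>F. S Q)) = emeasure M (S Q) + emeasure M (\<Union>Q\<in>F. S Q)"
      using m disj by (intro plus_emeasure[symmetric])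
    also have "\<dots> \<le> emeasure N (S Q) + emeasure N (\<Union>Q\<in>F. S Q)"
      using IH insert.prems(4) by (intro add_mono) auto
    also have "\<dots> = emeasure N (S Q \<union> (\<Union>Q\<in>F. S Q))"
      using m disj insert.prems(1) by (intro plus_emeasure) auto
    finally show ?thesis by simp
  qed
qed

text \<open>A stopping-time selection. Sets are visited by decreasing level, and a set joins
  \<open>G\<close> exactly when no chosen set containing it controls its value up to the factor
  \<open>A\<close>; failing that test is the jump inequality.\<close>

lemma principal_subfamily:
  fixes S :: "'b \<Rightarrow> 'a set" and level :: "'b \<Rightarrow> int" and \<Lambda> :: "'b \<Rightarrow> ennreal"
  assumes "finite F"
    and level: "\<And>Q R. Q \<in> F \<Longrightarrow> R \<in> F \<Longrightarrow> S Q \<subset> S R \<Longrightarrow> level Q < level R"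
    and A: "1 \<le> A"
  shows "\<exists>G\<subseteq>F. (\<forall>Q\<in>F. \<exists>R\<in>G. S Q \<subseteq> S R \<and> \<Lambda> Q \<le> A * \<Lambda> R) \<and>
    (\<forall>Q\<in>G. \<forall>R\<in>G. S Q \<subset> S R \<longrightarrow> A * \<Lambda> R < \<Lambda> Q)"
  using assms(1) level
proof (induction F rule: finite_ranking_induct[where f = "\<lambda>Q. - level Q"])
  case empty
  then show ?case by simp
next
  case (insert Q0 F)
  obtain G where G: "G \<subseteq> F" "\<forall>Q\<in>F. \<exists>R\<in>G. S Q \<subseteq> S R \<and> \<Lambda> Q \<le> A * \<Lambda> R"
    "\<forall>Q\<in>G. \<forall>R\<in>G. S Q \<subset> S R \<longrightarrow> A * \<Lambda> R < \<Lambda> Q"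
    using insert.IH insert.prems by (metis insertI2)
  show ?case
  proof (cases "\<exists>R\<in>G. S Q0 \<subseteq> S R \<and> \<Lambda> Q0 \<le> A * \<Lambda> R")
    case True
    then show ?thesis using G by (intro exI[of _ G]) auto
  next
    case False
    \<comment> \<open>\<open>Q0\<close> has the lowest level so far, so it is never the larger set
      of a strictly nested pair.\<close>
    have min: "\<not> S Q \<subset> S Q0" if "Q \<in> G" for Q
      using insert.prems[of Q Q0] insert.hyps(2)[of Q] that G(1) by fastforce
    have "\<Lambda> Q0 \<le> A * \<Lambda> Q0" using mult_right_mono[OF A, of "\<Lambda> Q0"] by simp
    then have 1: "\<forall>Q\<in>insert Q0 F. \<exists>R\<in>insert Q0 G. S Q \<subseteq> S R \<and> \<Lambda> Q \<le> A * \<Lambda> R"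
      using G(2) by auto
    have 2: "A * \<Lambda> R < \<Lambda> Q" if "Q \<in> insert Q0 G" "R \<in> insert Q0 G" "S Q \<subset> S R" for Q R
      using that G(3) False min[of Q] by (cases "Q = Q0"; cases "R = Q0") (auto simp: not_le psubset_imp_subset)
    show ?thesis using 1 2 G(1) by (intro exI[of _ "insert Q0 G"]) blast
  qed
qed

text \<open>Averages are compared with denominators cleared.\<close>

lemma emeasure_UN_strict_subsets_le:
  fixes S :: "'b \<Rightarrow> 'a set" and level :: "'b \<Rightarrow> int" and \<mu> :: "'i \<Rightarrow> 'a measure"
  assumes G: "finite G" and I: "finite I" "I \<noteq> {}"
    and sets: "\<And>i. i \<in> I \<Longrightarrow> sets (\<mu> i) = sets M" "\<And>Q. Q \<in> G \<Longrightarrow> S Q \<in> sets M"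
    and laminar: "\<And>Q R. Q \<in> G \<Longrightarrow> R \<in> G \<Longrightarrow> level Q \<le> level R \<Longrightarrow> S Q \<inter> S R = {} \<or> S Q \<subseteq> S R"
    and R: "R \<in> G" and fin: "\<And>i. i \<in> I \<Longrightarrow> emeasure (\<mu> i) (S R) < top"
    and avg: "\<And>Q. Q \<in> G \<Longrightarrow> S Q \<subset> S R \<Longrightarrow> \<exists>i\<in>I.
      of_nat (2 * card I) * emeasure (\<mu> i) (S R) * emeasure M (S Q) < emeasure M (S R) * emeasure (\<mu> i) (S Q)"
  shows "2 * emeasure M (\<Union>Q\<in>{Q \<in> G. S Q \<subset> S R}. S Q) \<le> emeasure M (S R)"
proof -
  define B :: ennreal where "B = of_nat (2 * card I)"
  \<comment> \<open>The sets are sorted by the index whose average jumps. Each class will cover at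
    most the fraction \<open>1 / B\<close> of \<open>S R\<close>, as in a weak-type estimate, and
    the \<open>card I\<close> classes together at most half.\<close>
  define H where "H i = {Q \<in> G. S Q \<subset> S R \<and>
      B * emeasure (\<mu> i) (S R) * emeasure M (S Q) < emeasure M (S R) * emeasure (\<mu> i) (S Q)}" for i
  define U where "U i = (\<Union>Q\<in>H i. S Q)" for i
  have finH: "finite (H i)" for i using G by (simp add: H_def)
  have Um: "U i \<in> sets M" for i unfolding U_def using sets(2) finH by (intro sets.finite_UN) (auto simp: H_def)
  have U: "B * emeasure M (U i) \<le> emeasure M (S R)" if i: "i \<in> I" for i
  \<comment> \<open>If \<open>S R\<close> has no mass, no jump is possible. Otherwise its mass is
    positive and finite and can be cancelled.\<close>
  proof (cases "emeasure (\<mu> i) (S R) = 0")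
    case True
    have "emeasure (\<mu> i) (S Q) = 0" if "S Q \<subset> S R" for Q
    proof -
      have "emeasure (\<mu> i) (S Q) \<le> emeasure (\<mu> i) (S R)"
        using that sets R i by (intro emeasure_mono) auto
      then show ?thesis using True by simp
    qed
    then have "H i = {}" by (auto simp: H_def)
    then show ?thesis by (simp add: U_def)
  next
    case False
    \<comment> \<open>With the constants absorbed into the measures, the jump condition compares two
      measures on each set of \<open>H i\<close>; laminarity carries the comparison over to the
      union.\<close>
    have "emeasure (scale_measure (B * emeasure (\<mu> i) (S R)) M) (U i)
        \<le> emeasure (scale_measure (emeasure M (S R)) (\<mu> i)) (U i)"
      unfolding U_def using sets i laminar finH
      by (intro emeasure_UN_le_laminar[where level = level]) (auto simp: H_def)
    then have "B * emeasure (\<mu> i) (S R) * emeasure M (U i) \<le> emeasure M (S R) * emeasure (\<mu> i) (U i)"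
      by simp
    also have "\<dots> \<le> emeasure M (S R) * emeasure (\<mu> i) (S R)"
      using sets R i by (intro mult_left_mono emeasure_mono) (auto simp: U_def H_def)
    finally have "emeasure (\<mu> i) (S R) * (B * emeasure M (U i)) \<le> emeasure (\<mu> i) (S R) * emeasure M (S R)"
      by (simp add: ac_simps)
    then show ?thesis using False fin[OF i]
      by (subst (asm) ennreal_mult_le_mult_iff) auto
  qed
  have sub: "(\<Union>Q\<in>{Q \<in> G. S Q \<subset> S R}. S Q) \<subseteq> (\<Union>i\<in>I. U i)"
  proof
    fix x assume "x \<in> (\<Union>Q\<in>{Q \<in> G. S Q \<subset> S R}. S Q)"
    then obtain Q where "Q \<in> G" "S Q \<subset> S R" "x \<in> S Q" by blast
    with avg \<open>Q \<in> G\<close> obtain i where "i \<in> I" "Q \<in> H i" unfolding H_def B_def by blast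
    with \<open>x \<in> S Q\<close> show "x \<in> (\<Union>i\<in>I. U i)" by (auto simp: U_def)
  qed
  have "B * emeasure M (\<Union>Q\<in>{Q \<in> G. S Q \<subset> S R}. S Q) \<le> B * emeasure M (\<Union>i\<in>I. U i)"
    using sub Um I by (intro mult_left_mono emeasure_mono) auto
  also have "\<dots> \<le> B * (\<Sum>i\<in>I. emeasure M (U i))"
    using Um I by (intro mult_left_mono emeasure_subadditive_finite) auto
  also have "\<dots> = (\<Sum>i\<in>I. B * emeasure M (U i))" by (rule sum_distrib_left)
  also have "\<dots> \<le> (\<Sum>i\<in>I. emeasure M (S R))" using U by (rule sum_mono)
  finally have "of_nat (card I) * (2 * emeasure M (\<Union>Q\<in>{Q \<in> G. S Q \<subset> S R}. S Q)) \<le> of_nat (card I) * emeasure M (S R)"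
    by (simp add: B_def ac_simps)
  then show ?thesis using I
    by (subst (asm) ennreal_mult_le_mult_iff) (auto simp: of_nat_less_top less_top[symmetric])
qed

section \<open>Shifted dyadic grids\<close>

text \<open>The dyadic grid of scale \<open>2\<^sup>k\<close> is translated by \<open>\<plusminus>2\<^sup>k/3\<close> in the coordinates from \<open>\<alpha>\<close>. The sign
  alternates with \<open>k\<close>, which is what makes the translated grids nested.\<close>

definition shift :: "'n set \<Rightarrow> int \<Rightarrow> 'n \<Rightarrow> int" where
  "shift \<alpha> k i = (if i \<in> \<alpha> then if even k then 1 else -1 else 0)"

definition grid_index :: "'n set \<Rightarrow> int \<Rightarrow> 'n \<Rightarrow> real \<Rightarrow> int" where
  "grid_index \<alpha> k i t = \<lfloor>t / 2 powi k - shift \<alpha> k i / 3\<rfloor>"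

text \<open>A pair (k, j) encodes a half-open cube of side \<open>2 powi k\<close>. Describing it by
  the grid indices of its points reduces nestedness to integer arithmetic.\<close>

definition dyadic :: "'n set \<Rightarrow> int \<times> (int^'n) \<Rightarrow> (real^'n) set" where
  "dyadic \<alpha> Q = {x. \<forall>i. grid_index \<alpha> (fst Q) i (x $ i) = snd Q $ i}"

definition dyadic_side :: "int \<times> (int^'n) \<Rightarrow> real" where
  "dyadic_side Q = 2 powi fst Q"

definition dyadic_corner :: "'n set \<Rightarrow> int \<times> (int^'n) \<Rightarrow> real^'n" where
  "dyadic_corner \<alpha> Q = (\<chi> i. 2 powi fst Q * (snd Q $ i + shift \<alpha> (fst Q) i / 3))"

section \<open>Half-open dyadic cubes: position, measurability, volume\<close>

lemma dyadic_side_pos [simp]: "0 < dyadic_side Q"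
  by (simp add: dyadic_side_def)

lemma dyadic_side_nonzero [simp]: "dyadic_side Q \<noteq> 0"
  by (simp add: dyadic_side_def)

lemma dyadic_side_power_not_le [simp]: "\<not> dyadic_side Q ^ k \<le> 0"
  by (simp add: not_le)

lemma mem_dyadic_iff:
  "x \<in> dyadic \<alpha> Q \<longleftrightarrow>
    (\<forall>i. dyadic_corner \<alpha> Q $ i \<le> x $ i \<and> x $ i < dyadic_corner \<alpha> Q $ i + dyadic_side Q)"
proof -
  have "grid_index \<alpha> (fst Q) i t = j \<longleftrightarrow>
      2 powi fst Q * (j + shift \<alpha> (fst Q) i / 3) \<le> t \<and>
      t < 2 powi fst Q * (j + shift \<alpha> (fst Q) i / 3) + 2 powi fst Q" for i t j
  proof -
    define h :: real where "h = 2 powi fst Q"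
    have h: "0 < h" by (simp add: h_def)
    then show ?thesis
      unfolding grid_index_def h_def[symmetric] floor_eq_iff by (simp add: field_simps)
  qed
  then show ?thesis by (simp add: dyadic_def dyadic_corner_def dyadic_side_def)
qed

lemma dyadic_subset_cube: "dyadic \<alpha> Q \<subseteq> cube (dyadic_corner \<alpha> Q) (dyadic_side Q)"
  by (auto simp: mem_dyadic_iff cube_def mem_box_cart less_imp_le)

lemma box_subset_dyadic:
  "box (dyadic_corner \<alpha> Q) (dyadic_corner \<alpha> Q + vec (dyadic_side Q)) \<subseteq> dyadic \<alpha> Q"
  by (auto simp: mem_dyadic_iff mem_box_cart less_imp_le)

lemma dyadic_sets [measurable]: "dyadic \<alpha> Q \<in> sets borel"
proof -
  have "dyadic \<alpha> Q = {x. \<forall>i\<in>UNIV. dyadic_corner \<alpha> Q $ i \<le> x $ i \<and> x $ i < dyadic_corner \<alpha> Q $ i + dyadic_side Q}"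
    by (auto simp: mem_dyadic_iff)
  also have "\<dots> \<in> sets borel" by measurable
  finally show ?thesis .
qed

lemma cube_borel [measurable]: "cube a l \<in> sets borel"
  by (simp add: cube_def)

lemma cube_lebesgue [measurable]: "cube a l \<in> sets lebesgue"
  by simp

lemma vec_inner_Basis: "b \<in> Basis \<Longrightarrow> vec l \<bullet> b = (l::real)"
  by (auto simp: Basis_vec_def inner_axis)

lemma emeasure_lborel_cube:
  fixes a :: "real^'n"
  assumes "0 < l"
  shows "emeasure lborel (cube a l) = ennreal (l ^ CARD('n))"
  using assms by (simp add: cube_def emeasure_lborel_cbox_eq vec_inner_Basis inner_add_left)

lemma measure_cube:
  fixes a :: "real^'n"
  assumes "0 < l"
  shows "measure lebesgue (cube a l) = l ^ CARD('n)"
  using assms by (simp add: measure_def emeasure_lborel_cube)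

lemma dyadic_lebesgue [measurable]: "dyadic \<alpha> Q \<in> sets lebesgue"
  by simp

lemma emeasure_lborel_dyadic:
  fixes Q :: "int \<times> (int^'n)"
  shows "emeasure lborel (dyadic \<alpha> Q) = ennreal (dyadic_side Q ^ CARD('n))"
proof (rule antisym)
  let ?a = "dyadic_corner \<alpha> Q" and ?l = "dyadic_side Q"
  have "emeasure lborel (dyadic \<alpha> Q) \<le> emeasure lborel (cube ?a ?l)"
    by (intro emeasure_mono dyadic_subset_cube) simp
  then show "emeasure lborel (dyadic \<alpha> Q) \<le> ennreal (?l ^ CARD('n))"
    by (simp add: emeasure_lborel_cube)
  have "ennreal (?l ^ CARD('n)) = emeasure lborel (box ?a (?a + vec ?l))"
    by (simp add: emeasure_lborel_box_eq vec_inner_Basis inner_add_left less_imp_le)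
  also have "\<dots> \<le> emeasure lborel (dyadic \<alpha> Q)"
    by (intro emeasure_mono box_subset_dyadic) simp
  finally show "ennreal (?l ^ CARD('n)) \<le> emeasure lborel (dyadic \<alpha> Q)" .
qed

lemma emeasure_dyadic:
  fixes Q :: "int \<times> (int^'n)"
  shows "emeasure lebesgue (dyadic \<alpha> Q) = ennreal (dyadic_side Q ^ CARD('n))"
  by (simp add: emeasure_lborel_dyadic)

text \<open>The half-open cube and its closed counterpart have the same finite volume. This
  transfers facts about closed cubes, such as the test condition, to dyadic ones.\<close>

lemma AE_dyadic_eq_cube:
  fixes Q :: "int \<times> (int^'n)"
  shows "AE x in lebesgue. x \<in> cube (dyadic_corner \<alpha> Q) (dyadic_side Q) \<longleftrightarrow> x \<in> dyadic \<alpha> Q"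
proof -
  let ?C = "cube (dyadic_corner \<alpha> Q) (dyadic_side Q)"
  have "emeasure lebesgue (?C - dyadic \<alpha> Q) = emeasure lebesgue ?C - emeasure lebesgue (dyadic \<alpha> Q)"
    by (intro emeasure_Diff dyadic_subset_cube) (auto simp: emeasure_lborel_dyadic)
  also have "\<dots> = 0" by (simp add: emeasure_lborel_dyadic emeasure_lborel_cube)
  finally have "?C - dyadic \<alpha> Q \<in> null_sets lebesgue" by (auto intro!: null_setsI)
  then have "AE x in lebesgue. x \<notin> ?C - dyadic \<alpha> Q" by (rule AE_not_in)
  then show ?thesis by eventually_elim (use dyadic_subset_cube[of \<alpha> Q] in blast)
qed

lemma nn_integral_cube_eq_dyadic:
  "(\<integral>\<^sup>+x\<in>cube (dyadic_corner \<alpha> Q) (dyadic_side Q). f x \<partial>lebesgue) = (\<integral>\<^sup>+x\<in>dyadic \<alpha> Q. f x \<partial>lebesgue)"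
  by (rule nn_integral_cong_AE) (use AE_dyadic_eq_cube in eventually_elim, auto split: split_indicator)

text \<open>The alternating sign gives -s'/3 = (-s/3 + s)/2 for consecutive shifts s and s' = -s.
  Hence the index at one level determines the index at the next.\<close>

lemma grid_index_Suc:
  "grid_index \<alpha> (k + 1) i t = (grid_index \<alpha> k i t + shift \<alpha> k i) div 2"
proof -
  have "t / 2 powi (k + 1) - shift \<alpha> (k + 1) i / 3
      = (t / 2 powi k - shift \<alpha> k i / 3 + of_int (shift \<alpha> k i)) / of_int 2"
    by (simp add: power_int_add shift_def field_simps)
  then show ?thesis unfolding grid_index_def
    by (simp only: floor_divide_real_eq_div floor_add_int)
qed

lemma grid_index_cong:
  assumes "grid_index \<alpha> k i s = grid_index \<alpha> k i t" "k \<le> k'"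
  shows "grid_index \<alpha> k' i s = grid_index \<alpha> k' i t"
  using assms(2) by (induction k' rule: int_ge_induct) (auto simp: assms(1) grid_index_Suc)

text \<open>A common point forces all points of the finer cube to share its indices at the level of
  \<open>Q\<close>, hence at every higher level, in particular that of \<open>R\<close>.\<close>

lemma dyadic_laminar:
  assumes "fst Q \<le> fst R"
  shows "dyadic \<alpha> Q \<inter> dyadic \<alpha> R = {} \<or> dyadic \<alpha> Q \<subseteq> dyadic \<alpha> R"
proof -
  have "y \<in> dyadic \<alpha> R" if "x \<in> dyadic \<alpha> Q" "x \<in> dyadic \<alpha> R" "y \<in> dyadic \<alpha> Q" for x y
    unfolding dyadic_def mem_Collect_eq
  proof
    fix i
    have "grid_index \<alpha> (fst Q) i (y $ i) = grid_index \<alpha> (fst Q) i (x $ i)"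
      using that by (simp add: dyadic_def)
    then have "grid_index \<alpha> (fst R) i (y $ i) = grid_index \<alpha> (fst R) i (x $ i)"
      by (rule grid_index_cong) (rule assms)
    then show "grid_index \<alpha> (fst R) i (y $ i) = snd R $ i" using that by (simp add: dyadic_def)
  qed
  then show ?thesis by blast
qed

lemma dyadic_corner_mem: "dyadic_corner \<alpha> Q \<in> dyadic \<alpha> Q"
  by (simp add: mem_dyadic_iff)

lemma dyadic_strict_subset_level:
  assumes "dyadic \<alpha> Q \<subset> dyadic \<alpha> R"
  shows "fst Q < fst R"
proof (rule ccontr)
  assume "\<not> fst Q < fst R"
  then have "dyadic \<alpha> R \<inter> dyadic \<alpha> Q = {} \<or> dyadic \<alpha> R \<subseteq> dyadic \<alpha> Q"
    by (intro dyadic_laminar) auto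
  then show False using assms dyadic_corner_mem[of \<alpha> Q] by blast
qed

text \<open>The volume determines the level, and then any point of the cube determines the index
  vector.\<close>

lemma inj_dyadic: "inj (dyadic \<alpha> :: _ \<Rightarrow> (real^'n) set)"
proof (rule injI)
  fix Q R :: "int \<times> (int^'n)"
  assume eq: "dyadic \<alpha> Q = dyadic \<alpha> R"
  have "dyadic_side Q ^ CARD('n) = dyadic_side R ^ CARD('n)"
    using emeasure_dyadic[of \<alpha> Q] emeasure_dyadic[of \<alpha> R] eq by (simp add: less_imp_le)
  then have "dyadic_side Q = dyadic_side R"
    by (simp add: power_eq_iff_eq_base less_imp_le)
  then have k: "fst Q = fst R" by (simp add: dyadic_side_def powr_inj flip: powr_real_of_int')
  have "snd Q $ i = snd R $ i" for i
  proof -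
    have "dyadic_corner \<alpha> Q \<in> dyadic \<alpha> Q" "dyadic_corner \<alpha> Q \<in> dyadic \<alpha> R"
      using dyadic_corner_mem[of \<alpha> Q] eq by auto
    then show ?thesis using k by (simp add: dyadic_def)
  qed
  then show "Q = R" using k by (simp add: prod_eq_iff vec_eq_iff)
qed

text \<open>If an integer N separates the endpoints, both lie within 1/3 of N. A translation by 1/3
  in either direction then moves both to the same side of N without reaching another
  integer.\<close>

lemma one_third_trick:
  fixes u d s :: real
  assumes "0 \<le> d" "d < 1/3" "s = 1 \<or> s = -1"
  shows "\<lfloor>u\<rfloor> = \<lfloor>u + d\<rfloor> \<or> \<lfloor>u - s / 3\<rfloor> = \<lfloor>u + d - s / 3\<rfloor>"
proof (cases "\<lfloor>u\<rfloor> = \<lfloor>u + d\<rfloor>")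
  case False
  define N where "N = \<lfloor>u + d\<rfloor>"
  have N: "of_int N \<le> u + d" "u + d < of_int N + 1" by (auto simp: N_def)
  have u: "u < of_int N"
  proof (rule ccontr)
    assume "\<not> u < of_int N"
    then have "\<lfloor>u\<rfloor> = N" using N assms by (intro floor_unique) auto
    then show False using False by (simp add: N_def)
  qed
  have "\<lfloor>u - s / 3\<rfloor> = \<lfloor>u + d - s / 3\<rfloor>"
    using assms(3)
  proof
    assume s: "s = 1"
    have "\<lfloor>u - s / 3\<rfloor> = N - 1" "\<lfloor>u + d - s / 3\<rfloor> = N - 1"
      using N u assms(1,2) s by (intro floor_unique; simp)+
    then show ?thesis by simp
  next
    assume s: "s = -1"
    have "\<lfloor>u - s / 3\<rfloor> = N" "\<lfloor>u + d - s / 3\<rfloor> = N"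
      using N u assms(1,2) s by (intro floor_unique; simp)+
    then show ?thesis by simp
  qed
  then show ?thesis ..
qed simp

lemma cube_subset_dyadic:
  fixes a :: "real^'n"
  assumes l: "0 < l"
  obtains \<alpha> Q where "cube a l \<subseteq> dyadic \<alpha> Q" "l \<le> dyadic_side Q" "dyadic_side Q \<le> 6 * l"
proof -
  \<comment> \<open>This level satisfies 3 l < 2^k <= 6 l, so in units of the grid the cube has side
    below 1/3.\<close>
  define k where "k = \<lfloor>log 2 (3 * l)\<rfloor> + 1"
  define h :: real where "h = 2 powi k"
  have h: "h = 2 powr real_of_int k" by (simp add: h_def powr_real_of_int')
  have "3 * l < h"
  proof -
    have "3 * l = 2 powr (log 2 (3 * l))" using l by simp
    also have "\<dots> < 2 powr real_of_int k" unfolding k_def by (intro powr_less_mono) linarith+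
    finally show ?thesis by (simp add: h)
  qed
  have "h \<le> 6 * l"
  proof -
    have "2 powr real_of_int k \<le> 2 powr (log 2 (3 * l) + 1)" unfolding k_def by (intro powr_mono) linarith+
    also have "\<dots> = 6 * l" using l by (simp add: powr_add)
    finally show ?thesis by (simp add: h)
  qed
  have h0: "0 < h" by (simp add: h_def)
  define s :: int where "s = (if even k then 1 else -1)"
  \<comment> \<open>Only those coordinates are shifted in which the unshifted grid separates the two
    endpoints of the cube.\<close>
  define \<alpha> where "\<alpha> = {i. \<lfloor>a $ i / h\<rfloor> \<noteq> \<lfloor>(a $ i + l) / h\<rfloor>}"
  define Q where "Q = (k, \<chi> i. grid_index \<alpha> k i (a $ i))"
  have ends: "grid_index \<alpha> k i (a $ i) = grid_index \<alpha> k i (a $ i + l)" for i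
  proof (cases "i \<in> \<alpha>")
    case True
    have "\<lfloor>a $ i / h\<rfloor> = \<lfloor>a $ i / h + l / h\<rfloor> \<or> \<lfloor>a $ i / h - s / 3\<rfloor> = \<lfloor>a $ i / h + l / h - s / 3\<rfloor>"
      using l h0 \<open>3 * l < h\<close> by (intro one_third_trick) (auto simp: s_def field_simps)
    then show ?thesis using True
      by (simp add: grid_index_def shift_def \<alpha>_def s_def h_def add_divide_distrib)
  next
    case False
    then show ?thesis by (simp add: grid_index_def shift_def \<alpha>_def h_def)
  qed
  have mono: "grid_index \<alpha> k i t \<le> grid_index \<alpha> k i t'" if "t \<le> t'" for i t t'
    unfolding grid_index_def using that by (intro floor_mono diff_right_mono divide_right_mono) auto
  show thesis
  proof (rule that)
    show "cube a l \<subseteq> dyadic \<alpha> Q"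
    proof
      fix x assume "x \<in> cube a l"
      then have x: "a $ i \<le> x $ i" "x $ i \<le> a $ i + l" for i by (auto simp: cube_def mem_box_cart)
      have "grid_index \<alpha> k i (x $ i) = grid_index \<alpha> k i (a $ i)" for i
        using mono[OF x(1)[of i], of i] mono[OF x(2)[of i], of i] ends[of i] by simp
      then show "x \<in> dyadic \<alpha> Q" by (simp add: dyadic_def Q_def)
    qed
    show "l \<le> dyadic_side Q" "dyadic_side Q \<le> 6 * l"
      using \<open>3 * l < h\<close> \<open>h \<le> 6 * l\<close> l by (auto simp: dyadic_side_def Q_def h_def)
  qed
qed

section \<open>Averages in Banach function spaces\<close>

lemma nn_integral_lebesgue_scaleR:
  fixes f :: "real^'n \<Rightarrow> ennreal"
  assumes f[measurable]: "f \<in> borel_measurable lebesgue" and l: "0 < l"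
  shows "(\<integral>\<^sup>+x. f x \<partial>lebesgue) = ennreal (l ^ CARD('n)) * (\<integral>\<^sup>+x. f (l *\<^sub>R x) \<partial>lebesgue)"
proof -
  \<comment> \<open>The affine map in \<open>lebesgue_affine_euclidean\<close>, taken with equal
    factors and no translation, is the dilation by \<open>l\<close>.\<close>
  have T: "(\<lambda>x. 0 + (\<Sum>j\<in>Basis. (l * (x \<bullet> j)) *\<^sub>R j)) = (\<lambda>x::real^'n. l *\<^sub>R x)"
    unfolding scaleR_scaleR[symmetric] scaleR_sum_right[symmetric] euclidean_representation by simp
  have eq: "(lebesgue :: (real^'n) measure)
      = density (distr lebesgue lebesgue (\<lambda>x. l *\<^sub>R x)) (\<lambda>_. ennreal (l ^ CARD('n)))"
    using lebesgue_affine_euclidean[where c = "\<lambda>_. l" and t = "0 :: real^'n"] l unfolding T by simp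
  have "(\<integral>\<^sup>+x. f x \<partial>lebesgue)
      = (\<integral>\<^sup>+x. f x \<partial>density (distr lebesgue lebesgue (\<lambda>x. l *\<^sub>R x)) (\<lambda>_. ennreal (l ^ CARD('n))))"
    by (subst eq) (rule refl)
  also have "\<dots> = (\<integral>\<^sup>+x. ennreal (l ^ CARD('n)) * f x \<partial>distr lebesgue lebesgue (\<lambda>x. l *\<^sub>R x))"
    by (rule nn_integral_density) auto
  also have "\<dots> = (\<integral>\<^sup>+x. ennreal (l ^ CARD('n)) * f (l *\<^sub>R x) \<partial>lebesgue)"
    by (rule nn_integral_distr) auto
  also have "\<dots> = ennreal (l ^ CARD('n)) * (\<integral>\<^sup>+x. f (l *\<^sub>R x) \<partial>lebesgue)"
    by (rule nn_integral_cmult) (rule measurable_compose[OF lebesgue_measurable_scaling f])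
  finally show ?thesis .
qed

text \<open>Dividing \<open>g\<close> by its norm makes it a competitor in the supremum that defines
  the associate norm of \<open>f\<close>. If the norm is 0, then \<open>g\<close> vanishes
  a.e.\<close>

lemma (in banach_function_norm) Hoelder_associate:
  assumes [measurable]: "f \<in> borel_measurable lebesgue" "g \<in> borel_measurable lebesgue"
    and fin: "\<rho> g < top"
  shows "(\<integral>\<^sup>+x. f x * g x \<partial>lebesgue) \<le> associate_norm \<rho> f * \<rho> g"
proof (cases "\<rho> g = 0")
  case True
  then have "AE x in lebesgue. f x * g x = 0" using eq_0_iff[of g] by auto
  then have "(\<integral>\<^sup>+x. f x * g x \<partial>lebesgue) = 0" by (subst nn_integral_0_iff_AE) auto
  then show ?thesis by simp
next
  case False
  define r where "r = enn2real (\<rho> g)"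
  have r: "0 < r" "\<rho> g = ennreal r" using False fin
    by (auto simp: r_def enn2real_positive_iff zero_less_iff_neq_zero)
  have "\<rho> (\<lambda>x. ennreal (1 / r) * g x) = ennreal (1 / r) * \<rho> g"
    using r by (intro homogeneous) auto
  also have "\<dots> = 1" using r by (simp flip: ennreal_mult)
  finally have 1: "\<rho> (\<lambda>x. ennreal (1 / r) * g x) \<le> 1" by simp
  have "(\<integral>\<^sup>+x. f x * g x \<partial>lebesgue) = ennreal r * (ennreal (1 / r) * (\<integral>\<^sup>+x. f x * g x \<partial>lebesgue))"
    using r by (simp flip: ennreal_mult mult.assoc)
  also have "ennreal (1 / r) * (\<integral>\<^sup>+x. f x * g x \<partial>lebesgue) = (\<integral>\<^sup>+x. (ennreal (1 / r) * g x) * f x \<partial>lebesgue)"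
    by (subst nn_integral_cmult[symmetric]) (auto simp: ac_simps)
  also have "ennreal r * \<dots> \<le> ennreal r * associate_norm \<rho> f"
    unfolding associate_norm_def using 1 by (intro mult_left_mono SUP_upper) auto
  finally show ?thesis using r by (simp add: mult.commute)
qed

lemma borel_measurable_abs_dilation:
  assumes [measurable]: "f \<in> borel_measurable lebesgue"
  shows "(\<lambda>x. ennreal \<bar>dilation l (\<lambda>x. f x * indicator (cube a l) x) x\<bar>) \<in> borel_measurable lebesgue"
  unfolding dilation_def
  by (rule measurable_compose[OF lebesgue_measurable_scaling, of "\<lambda>x. ennreal \<bar>f x * indicator (cube a l) x\<bar>"]) measurable

text \<open>The change of variables by the dilation produces the volume of the cube as a factor and
  turns both functions into those whose norms define the averages.\<close>

lemma Hoelder_bfs_average: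
  fixes \<rho> :: "(real^'n \<Rightarrow> ennreal) \<Rightarrow> ennreal"
  assumes "banach_function_norm \<rho>"
    and [measurable]: "f \<in> borel_measurable lebesgue" "g \<in> borel_measurable lebesgue"
    and l: "0 < l" and fin: "bfs_average \<rho> a l g < top"
  shows "(\<integral>\<^sup>+x\<in>cube a l. ennreal \<bar>f x * g x\<bar> \<partial>lebesgue)
    \<le> ennreal (l ^ CARD('n)) * (bfs_average (associate_norm \<rho>) a l f * bfs_average \<rho> a l g)"
proof -
  interpret banach_function_norm \<rho> by fact
  let ?F = "\<lambda>x. ennreal \<bar>dilation l (\<lambda>x. f x * indicator (cube a l) x) x\<bar>"
  let ?G = "\<lambda>x. ennreal \<bar>dilation l (\<lambda>x. g x * indicator (cube a l) x) x\<bar>"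
  have "(\<integral>\<^sup>+x\<in>cube a l. ennreal \<bar>f x * g x\<bar> \<partial>lebesgue)
      = ennreal (l ^ CARD('n)) * (\<integral>\<^sup>+x. ennreal \<bar>f (l *\<^sub>R x) * g (l *\<^sub>R x)\<bar> * indicator (cube a l) (l *\<^sub>R x) \<partial>lebesgue)"
    by (rule nn_integral_lebesgue_scaleR) (use l in auto)
  also have "(\<integral>\<^sup>+x. ennreal \<bar>f (l *\<^sub>R x) * g (l *\<^sub>R x)\<bar> * indicator (cube a l) (l *\<^sub>R x) \<partial>lebesgue)
      = (\<integral>\<^sup>+x. ?F x * ?G x \<partial>lebesgue)"
    by (intro nn_integral_cong)
       (auto simp: dilation_def abs_mult ennreal_mult split: split_indicator)
  also have "\<dots> \<le> associate_norm \<rho> ?F * \<rho> ?G"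
    using fin by (intro Hoelder_associate borel_measurable_abs_dilation)
      (auto simp: bfs_average_def bfs_norm_def)
  finally show ?thesis by (simp add: bfs_average_def bfs_norm_def mult_left_mono)
qed

text \<open>A zero average would make \<open>g\<close> vanish a.e. on a cube of positive measure.
  The lemma keeps a product of averages from hiding an infinite factor behind a zero one.\<close>

lemma bfs_average_nonzero:
  fixes \<rho> :: "(real^'n \<Rightarrow> ennreal) \<Rightarrow> ennreal"
  assumes "banach_function_norm \<rho>"
    and [measurable]: "g \<in> borel_measurable lebesgue"
    and nz: "AE x in lebesgue. g x \<noteq> 0" and l: "0 < l"
  shows "bfs_average \<rho> a l g \<noteq> 0"
proof
  interpret banach_function_norm \<rho> by fact
  let ?G = "\<lambda>x. ennreal \<bar>dilation l (\<lambda>x. g x * indicator (cube a l) x) x\<bar>"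
  have Gm [measurable]: "?G \<in> borel_measurable lebesgue"
    by (intro borel_measurable_abs_dilation) simp
  assume "bfs_average \<rho> a l g = 0"
  then have "AE x in lebesgue. ?G x = 0"
    using eq_0_iff[OF Gm] by (simp only: bfs_average_def bfs_norm_def)
  then have "(\<integral>\<^sup>+x. ?G x \<partial>lebesgue) = 0"
    by (simp only: nn_integral_0_iff_AE[OF Gm])
  moreover have "(\<integral>\<^sup>+x. ennreal \<bar>g x * indicator (cube a l) x\<bar> \<partial>lebesgue)
      = ennreal (l ^ CARD('n)) * (\<integral>\<^sup>+x. ?G x \<partial>lebesgue)"
    unfolding dilation_def by (rule nn_integral_lebesgue_scaleR) (use l in auto)
  ultimately have "(\<integral>\<^sup>+x. ennreal \<bar>g x * indicator (cube a l) x\<bar> \<partial>lebesgue) = 0"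
    by (simp only: mult_zero_right)
  then have "AE x in lebesgue. ennreal \<bar>g x * indicator (cube a l) x\<bar> = 0"
    by (subst (asm) nn_integral_0_iff_AE) auto
  with nz have "AE x in lebesgue. x \<notin> cube a l"
    by eventually_elim (auto split: split_indicator_asm)
  then have "emeasure lebesgue (cube a l) = 0"
    by (subst (asm) AE_iff_measurable[OF _ refl]) (auto simp: cube_def)
  then show False using l by (simp add: emeasure_lborel_cube)
qed

text \<open>Monotone convergence along the finite sets of indices with code below \<open>n\<close>
  reduces suprema over all dyadic cubes to finite families.\<close>

lemma nn_integral_SUP_countable_le:
  fixes g :: "'b::countable \<Rightarrow> 'a \<Rightarrow> ennreal"
  assumes g: "\<And>Q. g Q \<in> borel_measurable M"
    and fin: "\<And>F. finite F \<Longrightarrow> F \<subseteq> D \<Longrightarrow> (\<integral>\<^sup>+x. (SUP Q\<in>F. g Q x) \<partial>M) \<le> K"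
  shows "(\<integral>\<^sup>+x. (SUP Q\<in>D. g Q x) \<partial>M) \<le> K"
proof -
  define F where "F n = {Q \<in> D. to_nat Q < n}" for n
  have finF: "finite (F n)" for n
  proof (rule finite_imageD)
    show "finite (to_nat ` F n)" by (rule finite_subset[of _ "{..<n}"]) (auto simp: F_def)
    show "inj_on to_nat (F n)" by (rule inj_on_subset[OF inj_to_nat]) simp
  qed
  have D: "D = (\<Union>n. F n)" by (auto simp: F_def)
  have "(\<integral>\<^sup>+x. (SUP Q\<in>D. g Q x) \<partial>M) = (\<integral>\<^sup>+x. (SUP n. SUP Q\<in>F n. g Q x) \<partial>M)"
    unfolding D SUP_UNION ..
  also have "\<dots> = (SUP n. \<integral>\<^sup>+x. (SUP Q\<in>F n. g Q x) \<partial>M)"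
  proof (rule nn_integral_monotone_convergence_SUP)
    show "incseq (\<lambda>n x. SUP Q\<in>F n. g Q x)"
      by (auto simp: incseq_def le_fun_def F_def intro!: SUP_subset_mono)
    show "(\<lambda>x. SUP Q\<in>F n. g Q x) \<in> borel_measurable M" for n
      using g by (intro borel_measurable_SUP) auto
  qed
  also have "\<dots> \<le> K" using finF by (intro SUP_least fin) (auto simp: F_def)
  finally show ?thesis .
qed

section \<open>The dyadic maximal function\<close>

definition dyadic_average_prod ::
    "(real \<Rightarrow> real) \<Rightarrow> nat \<Rightarrow> (nat \<Rightarrow> real^'n \<Rightarrow> real) \<Rightarrow> 'n set \<Rightarrow> int \<times> (int^'n) \<Rightarrow> ennreal" where
  "dyadic_average_prod \<phi> m f \<alpha> Q =
     ennreal (\<phi> (dyadic_side Q ^ CARD('n))) *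
     (\<Prod>i=1..m. ennreal (1 / dyadic_side Q ^ CARD('n)) * (\<integral>\<^sup>+y\<in>dyadic \<alpha> Q. ennreal \<bar>f i y\<bar> \<partial>lebesgue))"

text \<open>An arbitrary cube is replaced by a dyadic one of at most six times its side. Each of the
  \<open>m\<close> averages loses at most \<open>6 ^ CARD('n)\<close>, and \<open>\<phi>\<close>
  loses \<open>r\<close> because the volume does not decrease.\<close>

lemma multilinear_maximal_le:
  fixes f :: "nat \<Rightarrow> real^'n \<Rightarrow> real"
  assumes \<phi>: "\<And>t s. 0 < t \<Longrightarrow> t \<le> s \<Longrightarrow> \<phi> t \<le> r * \<phi> s" and r: "0 < r"
    and le: "\<And>\<alpha> Q. x \<in> dyadic \<alpha> Q \<Longrightarrow> dyadic_average_prod \<phi> m f \<alpha> Q \<le> y"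
  shows "multilinear_maximal \<phi> m f x \<le> ennreal (r * (6 ^ CARD('n)) ^ m) * y"
  unfolding multilinear_maximal_def
proof (rule SUP_least, clarify)
  fix a :: "real^'n" and l :: real
  assume l: "0 < l" and x: "x \<in> cube a l"
  obtain \<alpha> Q where Q: "cube a l \<subseteq> dyadic \<alpha> Q" "l \<le> dyadic_side Q" "dyadic_side Q \<le> 6 * l"
    using cube_subset_dyadic[OF l] by blast
  let ?s = "dyadic_side Q ^ CARD('n)"
  have s: "?s \<le> 6 ^ CARD('n) * l ^ CARD('n)"
    using power_mono[OF Q(3)] by (simp add: power_mult_distrib less_imp_le)
  have avg: "ennreal (1 / l ^ CARD('n)) * (\<integral>\<^sup>+y\<in>cube a l. ennreal \<bar>f i y\<bar> \<partial>lebesgue)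
      \<le> ennreal (6 ^ CARD('n)) * (ennreal (1 / ?s) * (\<integral>\<^sup>+y\<in>dyadic \<alpha> Q. ennreal \<bar>f i y\<bar> \<partial>lebesgue))" for i
  proof -
    have "1 / l ^ CARD('n) \<le> 6 ^ CARD('n) * (1 / ?s)"
      using s l by (simp add: field_simps)
    then have "ennreal (1 / l ^ CARD('n)) \<le> ennreal (6 ^ CARD('n)) * ennreal (1 / ?s)"
      by (subst ennreal_mult[symmetric]) (auto simp: less_imp_le intro!: ennreal_leI)
    moreover have "(\<integral>\<^sup>+y\<in>cube a l. ennreal \<bar>f i y\<bar> \<partial>lebesgue) \<le> (\<integral>\<^sup>+y\<in>dyadic \<alpha> Q. ennreal \<bar>f i y\<bar> \<partial>lebesgue)"
      using Q(1) by (intro nn_integral_mono) (auto split: split_indicator)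
    ultimately show ?thesis by (subst mult.assoc[symmetric]) (rule mult_mono, auto)
  qed
  have "ennreal (\<phi> (l ^ CARD('n))) \<le> ennreal (r * \<phi> ?s)"
    using l Q(2) by (intro ennreal_leI \<phi> power_mono) auto
  also have "\<dots> = ennreal r * ennreal (\<phi> ?s)" using r by (simp add: ennreal_mult')
  finally have "ennreal (\<phi> (l ^ CARD('n))) *
        (\<Prod>i=1..m. ennreal (1 / l ^ CARD('n)) * (\<integral>\<^sup>+y\<in>cube a l. ennreal \<bar>f i y\<bar> \<partial>lebesgue))
      \<le> (ennreal r * ennreal (\<phi> ?s)) *
        (\<Prod>i=1..m. ennreal (6 ^ CARD('n)) * (ennreal (1 / ?s) * (\<integral>\<^sup>+y\<in>dyadic \<alpha> Q. ennreal \<bar>f i y\<bar> \<partial>lebesgue)))"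
    by (intro mult_mono prod_mono_ennreal avg) auto
  also have "\<dots> = (ennreal r * ennreal (6 ^ CARD('n)) ^ m) * dyadic_average_prod \<phi> m f \<alpha> Q"
    by (simp only: prod.distrib prod_constant card_atLeastAtMost dyadic_average_prod_def) (simp add: ac_simps)
  also have "ennreal r * ennreal (6 ^ CARD('n)) ^ m = ennreal (r * (6 ^ CARD('n)) ^ m)"
    using r by (subst ennreal_power) (auto simp: ennreal_mult)
  also have "\<dots> * dyadic_average_prod \<phi> m f \<alpha> Q \<le> \<dots> * y"
    using x Q(1) by (intro mult_left_mono le) auto
  finally show "ennreal (\<phi> (measure lebesgue (cube a l))) *
       (\<Prod>i=1..m. ennreal (1 / measure lebesgue (cube a l)) * (\<integral>\<^sup>+y\<in>cube a l. ennreal \<bar>f i y\<bar> \<partial>lebesgue))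
     \<le> ennreal (r * (6 ^ CARD('n)) ^ m) * y"
    using l by (simp only: measure_cube)
qed

text \<open>By contraposition: if each of the \<open>m\<close> averages grew by at most the factor
  \<open>B\<close> from \<open>R\<close> to the smaller cube \<open>Q\<close>, their product would
  grow by at most \<open>B ^ m\<close>, and \<open>\<phi>\<close> by at most
  \<open>r\<close>.\<close>

lemma exists_large_average:
  fixes f :: "nat \<Rightarrow> real^'n \<Rightarrow> real" and Q R :: "int \<times> (int^'n)"
  assumes \<phi>: "\<And>t s. 0 < t \<Longrightarrow> t \<le> s \<Longrightarrow> \<phi> t \<le> r * \<phi> s" and r: "0 < r"
    and QR: "dyadic \<alpha> Q \<subset> dyadic \<alpha> R" and B: "0 \<le> B"
    and less: "ennreal (r * B ^ m) * dyadic_average_prod \<phi> m f \<alpha> R < dyadic_average_prod \<phi> m f \<alpha> Q"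
  shows "\<exists>i\<in>{1..m}. ennreal B * (\<integral>\<^sup>+y\<in>dyadic \<alpha> R. ennreal \<bar>f i y\<bar> \<partial>lebesgue) * emeasure lebesgue (dyadic \<alpha> Q)
    < emeasure lebesgue (dyadic \<alpha> R) * (\<integral>\<^sup>+y\<in>dyadic \<alpha> Q. ennreal \<bar>f i y\<bar> \<partial>lebesgue)"
proof (rule ccontr)
  let ?I = "\<lambda>Q i. \<integral>\<^sup>+y\<in>dyadic \<alpha> Q. ennreal \<bar>f i y\<bar> \<partial>lebesgue"
  let ?s = "\<lambda>Q::int \<times> (int^'n). dyadic_side Q ^ CARD('n)"
  assume neg: "\<not> (\<exists>i\<in>{1..m}. ennreal B * ?I R i * emeasure lebesgue (dyadic \<alpha> Q)
    < emeasure lebesgue (dyadic \<alpha> R) * ?I Q i)"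
  have avg: "ennreal (1 / ?s Q) * ?I Q i \<le> ennreal B * (ennreal (1 / ?s R) * ?I R i)" if "i \<in> {1..m}" for i
  proof -
    have "ennreal (?s R) * ?I Q i \<le> ennreal B * ?I R i * ennreal (?s Q)"
      using neg that by (simp only: emeasure_dyadic not_less ball_simps bex_simps)
    \<comment> \<open>Dividing by both volumes turns the inequality with cleared denominators back
      into one between averages.\<close>
    then have "ennreal (1 / (?s Q * ?s R)) * (ennreal (?s R) * ?I Q i)
        \<le> ennreal (1 / (?s Q * ?s R)) * (ennreal B * ?I R i * ennreal (?s Q))"
      by (rule mult_left_mono) simp
    moreover have "ennreal (1 / (?s Q * ?s R)) * (ennreal (?s R) * ?I Q i) = ennreal (1 / ?s Q) * ?I Q i"
    proof -
      have "ennreal (1 / (?s Q * ?s R)) * ennreal (?s R) = ennreal (1 / ?s Q)"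
        by (subst ennreal_mult[symmetric]) (auto simp: less_imp_le)
      then show ?thesis by (simp add: mult.assoc[symmetric])
    qed
    moreover have "ennreal (1 / (?s Q * ?s R)) * (ennreal B * ?I R i * ennreal (?s Q)) = ennreal B * (ennreal (1 / ?s R) * ?I R i)"
    proof -
      have "ennreal (1 / (?s Q * ?s R)) * ennreal (?s Q) = ennreal (1 / ?s R)"
        by (subst ennreal_mult[symmetric]) (auto simp: less_imp_le)
      moreover have "ennreal (1 / (?s Q * ?s R)) * (ennreal B * ?I R i * ennreal (?s Q))
          = ennreal B * ((ennreal (1 / (?s Q * ?s R)) * ennreal (?s Q)) * ?I R i)" by (simp only: ac_simps)
      ultimately show ?thesis by (simp only:)
    qed
    ultimately show ?thesis by simp
  qed
  have "dyadic_side Q \<le> dyadic_side R"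
    using dyadic_strict_subset_level[OF QR] by (simp add: dyadic_side_def power_int_increasing)
  then have "ennreal (\<phi> (?s Q)) \<le> ennreal (r * \<phi> (?s R))"
    by (intro ennreal_leI \<phi> power_mono) (auto simp: less_imp_le)
  also have "\<dots> = ennreal r * ennreal (\<phi> (?s R))" using r by (simp add: ennreal_mult')
  finally have "dyadic_average_prod \<phi> m f \<alpha> Q
      \<le> (ennreal r * ennreal (\<phi> (?s R))) * (\<Prod>i=1..m. ennreal B * (ennreal (1 / ?s R) * ?I R i))"
    unfolding dyadic_average_prod_def by (intro mult_mono prod_mono_ennreal avg) auto
  also have "\<dots> = (ennreal r * ennreal B ^ m) * dyadic_average_prod \<phi> m f \<alpha> R"
    by (simp only: prod.distrib prod_constant card_atLeastAtMost dyadic_average_prod_def) (simp add: ac_simps)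
  also have "ennreal r * ennreal B ^ m = ennreal (r * B ^ m)"
    using r B by (simp add: ennreal_power ennreal_mult)
  finally show False using less by simp
qed

text \<open>Removing from each cube of the family the smaller ones leaves disjoint sets that carry at
  least half of the measure.\<close>

lemma sparse_sum_le:
  fixes c :: "int \<times> (int^'n) \<Rightarrow> ennreal"
  assumes G: "finite G"
    and sparse: "\<And>R. R \<in> G \<Longrightarrow>
      2 * emeasure lebesgue (\<Union>Q\<in>{Q \<in> G. dyadic \<alpha> Q \<subset> dyadic \<alpha> R}. dyadic \<alpha> Q) \<le> emeasure lebesgue (dyadic \<alpha> R)"
    and c: "\<And>R x. R \<in> G \<Longrightarrow> x \<in> dyadic \<alpha> R \<Longrightarrow> c R \<le> h x"
  shows "(\<Sum>R\<in>G. emeasure lebesgue (dyadic \<alpha> R) * c R) \<le> 2 * (\<integral>\<^sup>+x. h x \<partial>lebesgue)"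
proof -
  define U where "U R = (\<Union>Q\<in>{Q \<in> G. dyadic \<alpha> Q \<subset> dyadic \<alpha> R}. dyadic \<alpha> Q)" for R
  define E where "E R = dyadic \<alpha> R - U R" for R
  have Um [measurable]: "U R \<in> sets lebesgue" for R
    unfolding U_def using G by (intro sets.finite_UN) auto
  have Em [measurable]: "E R \<in> sets lebesgue" for R unfolding E_def by measurable
  have half: "emeasure lebesgue (dyadic \<alpha> R) \<le> 2 * emeasure lebesgue (E R)" if R: "R \<in> G" for R
  proof -
    let ?e = "emeasure lebesgue"
    have fin: "?e (dyadic \<alpha> R) \<noteq> top" by (simp add: emeasure_lborel_dyadic)
    have "dyadic \<alpha> R = E R \<union> U R" by (auto simp: E_def U_def)
    moreover have "?e (E R) + ?e (U R) = ?e (E R \<union> U R)"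
      by (rule plus_emeasure) (auto simp: E_def)
    ultimately have eq: "?e (dyadic \<alpha> R) = ?e (E R) + ?e (U R)" by simp
    \<comment> \<open>Doubling the decomposition makes room for \<open>sparse\<close>; one copy of
      the finite volume of the cube then cancels.\<close>
    have "?e (dyadic \<alpha> R) + ?e (dyadic \<alpha> R) = 2 * ?e (E R) + 2 * ?e (U R)"
      by (subst (1 2) eq) (simp add: mult_2 ac_simps)
    also have "\<dots> \<le> 2 * ?e (E R) + ?e (dyadic \<alpha> R)"
      using sparse[OF R] by (intro add_left_mono) (simp only: U_def)
    finally have "?e (dyadic \<alpha> R) + ?e (dyadic \<alpha> R) \<le> ?e (dyadic \<alpha> R) + 2 * ?e (E R)"
      by (simp only: add.commute)
    then show ?thesis using fin by (simp only: ennreal_add_left_cancel_le) auto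
  qed
  \<comment> \<open>Distinct cubes with a common point are strictly nested, so the point lies in the
    part removed from the larger one.\<close>
  have disj: "R = R'" if "R \<in> G" "R' \<in> G" "x \<in> E R" "x \<in> E R'" for R R' x
  proof (rule ccontr)
    assume "R \<noteq> R'"
    then have ne: "dyadic \<alpha> R \<noteq> dyadic \<alpha> R'" using inj_dyadic[of \<alpha>] by (auto dest: injD)
    have x: "x \<in> dyadic \<alpha> R" "x \<in> dyadic \<alpha> R'" using that by (auto simp: E_def)
    have "dyadic \<alpha> R \<subset> dyadic \<alpha> R' \<or> dyadic \<alpha> R' \<subset> dyadic \<alpha> R"
      using dyadic_laminar[of R R' \<alpha>] dyadic_laminar[of R' R \<alpha>] x ne by (cases "fst R \<le> fst R'") auto
    then show False using that x unfolding E_def U_def by blast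
  qed
  have "(\<Sum>R\<in>G. emeasure lebesgue (dyadic \<alpha> R) * c R) \<le> (\<Sum>R\<in>G. 2 * emeasure lebesgue (E R) * c R)"
    using half by (intro sum_mono mult_right_mono) auto
  also have "\<dots> = 2 * (\<Sum>R\<in>G. \<integral>\<^sup>+x. c R * indicator (E R) x \<partial>lebesgue)"
    by (simp only: nn_integral_cmult_indicator Em sum_distrib_left) (simp add: ac_simps)
  also have "(\<Sum>R\<in>G. \<integral>\<^sup>+x. c R * indicator (E R) x \<partial>lebesgue) = (\<integral>\<^sup>+x. (\<Sum>R\<in>G. c R * indicator (E R) x) \<partial>lebesgue)"
    by (rule nn_integral_sum[symmetric]) measurable
  also have "\<dots> \<le> (\<integral>\<^sup>+x. h x \<partial>lebesgue)"
  proof (rule nn_integral_mono)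
    fix x
    show "(\<Sum>R\<in>G. c R * indicator (E R) x) \<le> h x"
    proof (cases "\<exists>R\<in>G. x \<in> E R")
      case True
      then obtain R where R: "R \<in> G" "x \<in> E R" by blast
      have "c R' * indicator (E R') x = 0" if "R' \<in> G - {R}" for R'
        using that R disj[of R R' x] by (cases "x \<in> E R'") auto
      then have "(\<Sum>R'\<in>G - {R}. c R' * indicator (E R') x) = 0" by (rule sum.neutral[OF ballI])
      then have "(\<Sum>R\<in>G. c R * indicator (E R) x) = c R"
        using R by (subst sum.remove[OF G R(1)]) simp
      also have "\<dots> \<le> h x" using R c[of R x] by (auto simp: E_def)
      finally show ?thesis .
    next
      case False
      then have "(\<Sum>R\<in>G. c R * indicator (E R) x) = 0" by (intro sum.neutral) auto
      then show ?thesis by simp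
    qed
  qed
  finally show ?thesis by (simp add: mult_left_mono)
qed

text \<open>The stopping-time argument itself. In the application \<open>c i Q\<close> is the
  \<open>P i\<close>-th power of an average of \<open>f i * w i\<close>, and \<open>h i\<close> the
  same power of the corresponding maximal function.\<close>

lemma finite_dyadic_maximal_estimate:
  fixes f :: "nat \<Rightarrow> real^'n \<Rightarrow> real" and V :: "real^'n \<Rightarrow> ennreal"
    and c :: "nat \<Rightarrow> int \<times> (int^'n) \<Rightarrow> ennreal"
  assumes \<phi>: "\<And>t s. 0 < t \<Longrightarrow> t \<le> s \<Longrightarrow> \<phi> t \<le> r * \<phi> s" and r: "0 < r" and m: "1 \<le> m"
    and P: "\<And>i. i \<in> {1..m} \<Longrightarrow> 0 < P i" and q: "0 < q" "1 \<le> (\<Sum>i=1..m. q / P i)"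
    and F: "finite F"
    and f [measurable]: "\<And>i. i \<in> {1..m} \<Longrightarrow> f i \<in> borel_measurable lebesgue"
    and V [measurable]: "V \<in> borel_measurable lebesgue"
    and fin: "\<And>i Q. i \<in> {1..m} \<Longrightarrow> Q \<in> F \<Longrightarrow> (\<integral>\<^sup>+y\<in>dyadic \<alpha> Q. ennreal \<bar>f i y\<bar> \<partial>lebesgue) < top"
    and test: "\<And>Q. Q \<in> F \<Longrightarrow>
      ennreal_powr (dyadic_average_prod \<phi> m f \<alpha> Q) q * (\<integral>\<^sup>+x\<in>dyadic \<alpha> Q. V x \<partial>lebesgue)
      \<le> K * (\<Prod>i=1..m. ennreal_powr (emeasure lebesgue (dyadic \<alpha> Q) * c i Q) (q / P i))"
    and c: "\<And>i Q x. i \<in> {1..m} \<Longrightarrow> Q \<in> F \<Longrightarrow> x \<in> dyadic \<alpha> Q \<Longrightarrow> c i Q \<le> h i x"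
  shows "(\<integral>\<^sup>+x. (SUP Q\<in>F. ennreal_powr (dyadic_average_prod \<phi> m f \<alpha> Q) q * indicator (dyadic \<alpha> Q) x * V x) \<partial>lebesgue)
    \<le> ennreal_powr (ennreal (max 1 (r * real (2 * m) ^ m))) q * (K * (\<Prod>i=1..m. ennreal_powr (2 * (\<integral>\<^sup>+x. h i x \<partial>lebesgue)) (q / P i)))"
proof -
  \<comment> \<open>A jump by \<open>r * (2 * m) ^ m\<close> forces one of the \<open>m\<close>
    averages to jump by \<open>2 * m\<close>, the factor that sparseness requires. The maximum with
    1 serves \<open>principal_subfamily\<close>.\<close>
  define A where "A = ennreal (max 1 (r * real (2 * m) ^ m))"
  let ?\<Lambda> = "dyadic_average_prod \<phi> m f \<alpha>"
  let ?W = "\<lambda>Q. ennreal_powr (?\<Lambda> Q) q"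
  have "1 \<le> A" by (simp add: A_def)
  then obtain G where G: "G \<subseteq> F"
    and cover: "\<And>Q. Q \<in> F \<Longrightarrow> \<exists>R\<in>G. dyadic \<alpha> Q \<subseteq> dyadic \<alpha> R \<and> ?\<Lambda> Q \<le> A * ?\<Lambda> R"
    and jump: "\<And>Q R. Q \<in> G \<Longrightarrow> R \<in> G \<Longrightarrow> dyadic \<alpha> Q \<subset> dyadic \<alpha> R \<Longrightarrow> A * ?\<Lambda> R < ?\<Lambda> Q"
    using principal_subfamily[of F "dyadic \<alpha>" fst A ?\<Lambda>] F dyadic_strict_subset_level by metis
  have finG: "finite G" using G F by (rule finite_subset)
  define \<mu> where "\<mu> i = density lebesgue (\<lambda>y. ennreal \<bar>f i y\<bar>)" for i
  have \<mu>: "emeasure (\<mu> i) (dyadic \<alpha> Q) = (\<integral>\<^sup>+y\<in>dyadic \<alpha> Q. ennreal \<bar>f i y\<bar> \<partial>lebesgue)" if "i \<in> {1..m}" for i Q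
    unfolding \<mu>_def using f[OF that] by (subst emeasure_density) auto
  have sparse: "2 * emeasure lebesgue (\<Union>Q\<in>{Q \<in> G. dyadic \<alpha> Q \<subset> dyadic \<alpha> R}. dyadic \<alpha> Q) \<le> emeasure lebesgue (dyadic \<alpha> R)"
    if R: "R \<in> G" for R
  proof (rule emeasure_UN_strict_subsets_le[where I = "{1..m}" and \<mu> = \<mu> and level = fst, OF finG _ _ _ _ _ R])
    fix Q assume Q: "Q \<in> G" "dyadic \<alpha> Q \<subset> dyadic \<alpha> R"
    have "ennreal (r * real (2 * m) ^ m) * ?\<Lambda> R \<le> A * ?\<Lambda> R"
      unfolding A_def by (intro mult_right_mono ennreal_leI) auto
    also have "\<dots> < ?\<Lambda> Q" using Q R by (intro jump)
    finally have "\<exists>i\<in>{1..m}. ennreal (real (2 * m)) * (\<integral>\<^sup>+y\<in>dyadic \<alpha> R. ennreal \<bar>f i y\<bar> \<partial>lebesgue) * emeasure lebesgue (dyadic \<alpha> Q)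
        < emeasure lebesgue (dyadic \<alpha> R) * (\<integral>\<^sup>+y\<in>dyadic \<alpha> Q. ennreal \<bar>f i y\<bar> \<partial>lebesgue)"
      using \<phi> r Q by (intro exists_large_average) auto
    then show "\<exists>i\<in>{1..m}. of_nat (2 * card {1..m}) * emeasure (\<mu> i) (dyadic \<alpha> R) * emeasure lebesgue (dyadic \<alpha> Q)
        < emeasure lebesgue (dyadic \<alpha> R) * emeasure (\<mu> i) (dyadic \<alpha> Q)"
      by (simp only: ennreal_of_nat_eq_real_of_nat card_atLeastAtMost diff_Suc_1 \<mu> cong: bex_cong)
  next
    show "dyadic \<alpha> Q \<inter> dyadic \<alpha> R = {} \<or> dyadic \<alpha> Q \<subseteq> dyadic \<alpha> R" if "fst Q \<le> fst R" for Q R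
      using that by (rule dyadic_laminar)
    show "emeasure (\<mu> i) (dyadic \<alpha> R) < top" if "i \<in> {1..m}" for i
      using fin[OF that, of R] R G \<mu>[OF that] by auto
  qed (use m in \<open>auto simp: \<mu>_def\<close>)
  \<comment> \<open>At the price of \<open>A\<close> to the power \<open>q\<close>, the supremum
    over \<open>F\<close> is dominated by a sum over the principal cubes.\<close>
  have pt: "(SUP Q\<in>F. ?W Q * indicator (dyadic \<alpha> Q) x * V x)
      \<le> (\<Sum>R\<in>G. ennreal_powr A q * ?W R * (V x * indicator (dyadic \<alpha> R) x))" for x
  proof (rule SUP_least)
    fix Q assume "Q \<in> F"
    then obtain R where R: "R \<in> G" "dyadic \<alpha> Q \<subseteq> dyadic \<alpha> R" "?\<Lambda> Q \<le> A * ?\<Lambda> R" using cover by blast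
    have "?W Q \<le> ennreal_powr A q * ?W R"
      using R(3) q(1) ennreal_powr_mono[of q "?\<Lambda> Q" "A * ?\<Lambda> R"] by (simp add: ennreal_powr_mult)
    moreover have "indicator (dyadic \<alpha> Q) x \<le> (indicator (dyadic \<alpha> R) x :: ennreal)"
      using R(2) by (auto split: split_indicator)
    ultimately have "?W Q * indicator (dyadic \<alpha> Q) x * V x \<le> (ennreal_powr A q * ?W R) * indicator (dyadic \<alpha> R) x * V x"
      by (intro mult_mono) auto
    also have "\<dots> = ennreal_powr A q * ?W R * (V x * indicator (dyadic \<alpha> R) x)" by (simp add: ac_simps)
    also have "\<dots> \<le> (\<Sum>R\<in>G. ennreal_powr A q * ?W R * (V x * indicator (dyadic \<alpha> R) x))"
      using R(1) finG by (intro member_le_sum) auto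
    finally show "?W Q * indicator (dyadic \<alpha> Q) x * V x
      \<le> (\<Sum>R\<in>G. ennreal_powr A q * ?W R * (V x * indicator (dyadic \<alpha> R) x))" .
  qed
  have "(\<integral>\<^sup>+x. (SUP Q\<in>F. ?W Q * indicator (dyadic \<alpha> Q) x * V x) \<partial>lebesgue)
      \<le> (\<integral>\<^sup>+x. (\<Sum>R\<in>G. ennreal_powr A q * ?W R * (V x * indicator (dyadic \<alpha> R) x)) \<partial>lebesgue)"
    using pt by (rule nn_integral_mono)
  also have "\<dots> = (\<Sum>R\<in>G. \<integral>\<^sup>+x. ennreal_powr A q * ?W R * (V x * indicator (dyadic \<alpha> R) x) \<partial>lebesgue)"
    by (rule nn_integral_sum) measurable
  also have "\<dots> = (\<Sum>R\<in>G. ennreal_powr A q * ?W R * (\<integral>\<^sup>+x\<in>dyadic \<alpha> R. V x \<partial>lebesgue))"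
    by (intro sum.cong refl nn_integral_cmult) measurable
  also have "\<dots> = ennreal_powr A q * (\<Sum>R\<in>G. ?W R * (\<integral>\<^sup>+x\<in>dyadic \<alpha> R. V x \<partial>lebesgue))"
    by (simp add: sum_distrib_left mult.assoc)
  also have "\<dots> \<le> ennreal_powr A q * (\<Sum>R\<in>G. K * (\<Prod>i=1..m. ennreal_powr (emeasure lebesgue (dyadic \<alpha> R) * c i R) (q / P i)))"
    using G by (intro mult_left_mono sum_mono test) auto
  also have "\<dots> = ennreal_powr A q * (K * (\<Sum>R\<in>G. (\<Prod>i=1..m. ennreal_powr (emeasure lebesgue (dyadic \<alpha> R) * c i R) (q / P i))))"
    by (simp add: sum_distrib_left)
  \<comment> \<open>The discrete Hoelder inequality applies because the exponents
    \<open>q / P i\<close> sum to at least 1.\<close>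
  also have "\<dots> \<le> ennreal_powr A q * (K * (\<Prod>i=1..m. ennreal_powr (\<Sum>R\<in>G. emeasure lebesgue (dyadic \<alpha> R) * c i R) (q / P i)))"
    using finG P q by (intro mult_left_mono sum_prod_ennreal_powr_le) (auto simp: less_imp_le)
  also have "\<dots> \<le> ennreal_powr A q * (K * (\<Prod>i=1..m. ennreal_powr (2 * (\<integral>\<^sup>+x. h i x \<partial>lebesgue)) (q / P i)))"
    using finG sparse c G P q(1)
    by (intro mult_left_mono prod_mono_ennreal ennreal_powr_mono sparse_sum_le) (auto simp: less_imp_le)
  finally show ?thesis by (simp only: A_def)
qed

text \<open>Power counting on one cube: \<open>s\<close> is its volume, \<open>N\<close> the mass of
  the output weight on it, and \<open>\<beta> i\<close> and \<open>\<omega> i\<close> are the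
  averages supplied by Hoelder's inequality.\<close>

lemma test_condition_imp:
  fixes \<beta> \<omega> :: "nat \<Rightarrow> ennreal"
  assumes s: "0 < s" and q: "0 < q" and P: "\<And>i. i \<in> {1..m} \<Longrightarrow> 0 < P i"
    and p: "1 / p = (\<Sum>i=1..m. 1 / P i)" and \<phi>s: "0 < \<phi>s"
    and \<Lambda>: "\<Lambda> \<le> ennreal \<phi>s * (\<Prod>i=1..m. \<beta> i * \<omega> i)"
    and test: "ennreal (\<phi>s * s powr (1/q - 1/p)) * ennreal_powr (ennreal (1 / s) * N) (1/q) * (\<Prod>i=1..m. \<omega> i) \<le> C"
  shows "ennreal_powr \<Lambda> q * N \<le>
    ennreal_powr C q * (\<Prod>i=1..m. ennreal_powr (ennreal s * ennreal_powr (\<beta> i) (P i)) (q / P i))"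
proof -
  \<comment> \<open>The exponents 1/p, 1/q - 1/p and -1/q cancel. The last two powers of
    \<open>s\<close> are those in the test condition; the first remains.\<close>
  have s_powr: "ennreal \<phi>s = ennreal (s powr (1/p)) * ennreal (\<phi>s * s powr (1/q - 1/p)) * ennreal ((1 / s) powr (1/q))"
  proof -
    have "s powr (1/p) * (\<phi>s * s powr (1/q - 1/p)) * (1 / s) powr (1/q) = \<phi>s * (s powr (1/p + (1/q - 1/p) + - (1/q)))"
      using s by (simp only: powr_add) (simp add: powr_divide powr_minus_divide)
    also have "\<dots> = \<phi>s" using s by simp
    finally show ?thesis using \<phi>s s by (simp flip: ennreal_mult)
  qed
  have "\<Lambda> * ennreal_powr N (1/q) \<le> (ennreal \<phi>s * (\<Prod>i=1..m. \<beta> i * \<omega> i)) * ennreal_powr N (1/q)"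
    using \<Lambda> by (rule mult_right_mono) simp
  also have "\<dots> = (\<Prod>i=1..m. \<beta> i) * ennreal (s powr (1/p)) *
      (ennreal (\<phi>s * s powr (1/q - 1/p)) * ennreal_powr (ennreal (1 / s) * N) (1/q) * (\<Prod>i=1..m. \<omega> i))"
    using s by (subst s_powr) (simp add: prod.distrib ennreal_powr_mult ennreal_powr_ennreal ac_simps)
  also have "\<dots> \<le> (\<Prod>i=1..m. \<beta> i) * ennreal (s powr (1/p)) * C"
    using test by (rule mult_left_mono) simp
  finally have "ennreal_powr (\<Lambda> * ennreal_powr N (1/q)) q \<le> ennreal_powr ((\<Prod>i=1..m. \<beta> i) * ennreal (s powr (1/p)) * C) q"
    using q by (intro ennreal_powr_mono) auto
  then have "ennreal_powr \<Lambda> q * N \<le> ennreal_powr C q * (ennreal (s powr (q/p)) * (\<Prod>i=1..m. ennreal_powr (\<beta> i) q))"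
    using q by (simp add: ennreal_powr_mult ennreal_powr_powr ennreal_powr_prod ennreal_powr_ennreal powr_powr ac_simps)
  also have "ennreal (s powr (q/p)) * (\<Prod>i=1..m. ennreal_powr (\<beta> i) q)
      = (\<Prod>i=1..m. ennreal_powr (ennreal s * ennreal_powr (\<beta> i) (P i)) (q / P i))"
  proof -
    \<comment> \<open>This identity distributes the remaining power of the volume over the
      \<open>m\<close> factors.\<close>
    have "q / p = (\<Sum>i=1..m. q / P i)"
      using arg_cong[OF p, of "\<lambda>t. q * t"] by (simp add: sum_distrib_left)
    then have "s powr (q/p) = (\<Prod>i=1..m. s powr (q / P i))"
      using s by (simp only: powr_sum)
    then have "ennreal (s powr (q/p)) = (\<Prod>i=1..m. ennreal (s powr (q / P i)))"
      by (simp add: prod_ennreal)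
    moreover have "(\<Prod>i=1..m. ennreal_powr (ennreal s * ennreal_powr (\<beta> i) (P i)) (q / P i))
        = (\<Prod>i=1..m. ennreal (s powr (q / P i)) * ennreal_powr (\<beta> i) q)"
    proof (rule prod.cong[OF refl])
      fix i assume "i \<in> {1..m}"
      from P[OF this] show "ennreal_powr (ennreal s * ennreal_powr (\<beta> i) (P i)) (q / P i)
          = ennreal (s powr (q / P i)) * ennreal_powr (\<beta> i) q"
        using s by (simp add: ennreal_powr_mult ennreal_powr_ennreal ennreal_powr_powr)
    qed
    ultimately show ?thesis by (simp only: prod.distrib)
  qed
  finally show ?thesis .
qed

section \<open>Averages on single dyadic cubes and the estimate for a whole grid\<close>

lemma bfs_average_le_maximal:
  "x \<in> dyadic \<alpha> Q \<Longrightarrow>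
    bfs_average \<rho> (dyadic_corner \<alpha> Q) (dyadic_side Q) g \<le> bfs_maximal \<rho> g x"
  unfolding bfs_maximal_def
  by (rule SUP_upper2[of "(dyadic_corner \<alpha> Q, dyadic_side Q)"]) (use dyadic_subset_cube[of \<alpha> Q] in auto)

text \<open>An infinite average on \<open>Q\<close> would make the maximal function infinite
  throughout \<open>Q\<close>, which has positive measure.\<close>

lemma bfs_average_finite:
  fixes \<rho> :: "(real^'n \<Rightarrow> ennreal) \<Rightarrow> ennreal"
  assumes p: "0 < p" and fin: "(\<integral>\<^sup>+x. ennreal_powr (bfs_maximal \<rho> g x) p \<partial>lebesgue) < top"
  shows "bfs_average \<rho> (dyadic_corner \<alpha> Q) (dyadic_side Q) g < top"
proof -
  let ?\<beta> = "bfs_average \<rho> (dyadic_corner \<alpha> Q) (dyadic_side Q) g"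
  have "ennreal_powr ?\<beta> p * emeasure lebesgue (dyadic \<alpha> Q) = (\<integral>\<^sup>+x. ennreal_powr ?\<beta> p * indicator (dyadic \<alpha> Q) x \<partial>lebesgue)"
    by (rule nn_integral_cmult_indicator[symmetric]) simp
  also have "\<dots> \<le> (\<integral>\<^sup>+x. ennreal_powr (bfs_maximal \<rho> g x) p \<partial>lebesgue)"
    using p by (intro nn_integral_mono)
      (auto split: split_indicator intro!: ennreal_powr_mono bfs_average_le_maximal)
  finally have "ennreal_powr ?\<beta> p * emeasure lebesgue (dyadic \<alpha> Q) < top" using fin by (rule le_less_trans)
  then show ?thesis
    by (auto simp: emeasure_lborel_dyadic ennreal_top_mult ennreal_eq_0_iff less_top[symmetric])
qed

text \<open>Hoelder's inequality for the factorisation of \<open>f\<close> into \<open>f * w\<close>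
  and \<open>inverse w\<close>, valid a.e. since \<open>w\<close> is positive a.e.\<close>

lemma dyadic_average_le:
  fixes \<rho> :: "(real^'n \<Rightarrow> ennreal) \<Rightarrow> ennreal"
  assumes \<rho>: "banach_function_norm \<rho>"
    and f [measurable]: "f \<in> borel_measurable lebesgue" and w [measurable]: "w \<in> borel_measurable lebesgue"
    and pos: "AE x in lebesgue. 0 < w x"
    and fin: "bfs_average \<rho> (dyadic_corner \<alpha> Q) (dyadic_side Q) (\<lambda>x. inverse (w x)) < top"
  shows "ennreal (1 / dyadic_side Q ^ CARD('n)) * (\<integral>\<^sup>+y\<in>dyadic \<alpha> Q. ennreal \<bar>f y\<bar> \<partial>lebesgue)
    \<le> bfs_average (associate_norm \<rho>) (dyadic_corner \<alpha> Q) (dyadic_side Q) (\<lambda>x. f x * w x) *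
      bfs_average \<rho> (dyadic_corner \<alpha> Q) (dyadic_side Q) (\<lambda>x. inverse (w x))"
    (is "ennreal (1 / ?s) * ?I \<le> ?\<beta> * ?\<omega>")
proof -
  let ?C = "cube (dyadic_corner \<alpha> Q) (dyadic_side Q)"
  have "?I = (\<integral>\<^sup>+y\<in>?C. ennreal \<bar>f y\<bar> \<partial>lebesgue)"
    by (rule nn_integral_cube_eq_dyadic[symmetric])
  also have "\<dots> = (\<integral>\<^sup>+y\<in>?C. ennreal \<bar>f y * w y * inverse (w y)\<bar> \<partial>lebesgue)"
    by (rule nn_integral_cong_AE, rule eventually_mono[OF pos]) (simp add: mult.assoc)
  also have "\<dots> \<le> ennreal ?s * (?\<beta> * ?\<omega>)"
    using fin by (intro Hoelder_bfs_average \<rho>) auto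
  finally have "ennreal (1 / ?s) * ?I \<le> ennreal (1 / ?s) * (ennreal ?s * (?\<beta> * ?\<omega>))"
    by (rule mult_left_mono) simp
  also have "\<dots> = ?\<beta> * ?\<omega>"
    by (subst mult.assoc[symmetric], subst ennreal_mult[symmetric])
       (auto simp: less_imp_le )
  finally show ?thesis .
qed

lemma dyadic_maximal_estimate:
  fixes f :: "nat \<Rightarrow> real^'n \<Rightarrow> real" and V :: "real^'n \<Rightarrow> ennreal"
    and Y :: "nat \<Rightarrow> (real^'n \<Rightarrow> ennreal) \<Rightarrow> ennreal"
  assumes \<phi>: "\<And>t s. 0 < t \<Longrightarrow> t \<le> s \<Longrightarrow> \<phi> t \<le> r * \<phi> s" and r: "0 < r"
    and \<phi>_pos: "\<And>t. 0 < t \<Longrightarrow> 0 < \<phi> t" and m: "1 \<le> m"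
    and P: "\<And>i. i \<in> {1..m} \<Longrightarrow> 0 < P i" and q: "0 < q" "1 \<le> (\<Sum>i=1..m. q / P i)"
    and p: "1 / p = (\<Sum>i=1..m. 1 / P i)"
    and Y: "\<And>i. i \<in> {1..m} \<Longrightarrow> banach_function_norm (Y i)"
    and f [measurable]: "\<And>i. i \<in> {1..m} \<Longrightarrow> f i \<in> borel_measurable lebesgue"
    and w [measurable]: "\<And>i. i \<in> {1..m} \<Longrightarrow> w i \<in> borel_measurable lebesgue"
    and w_pos: "\<And>i. i \<in> {1..m} \<Longrightarrow> AE x in lebesgue. 0 < w i x"
    and V [measurable]: "V \<in> borel_measurable lebesgue"
    and test: "\<And>a l. 0 < l \<Longrightarrow>
       ennreal (\<phi> (measure lebesgue (cube a l)) * measure lebesgue (cube a l) powr (1/q - 1/p)) *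
       ennreal_powr (ennreal (1 / measure lebesgue (cube a l)) * (\<integral>\<^sup>+x\<in>cube a l. V x \<partial>lebesgue)) (1/q) *
       (\<Prod>i=1..m. bfs_average (Y i) a l (\<lambda>x. inverse (w i x))) \<le> C"
    and C: "C < top"
    and h: "\<And>i. i \<in> {1..m} \<Longrightarrow> (\<integral>\<^sup>+x. h i x \<partial>lebesgue) < top"
    and h_def: "\<And>i x. h i x = ennreal_powr (bfs_maximal (associate_norm (Y i)) (\<lambda>x. f i x * w i x) x) (P i)"
  shows "(\<integral>\<^sup>+x. (SUP Q. ennreal_powr (dyadic_average_prod \<phi> m f \<alpha> Q) q * indicator (dyadic \<alpha> Q) x * V x) \<partial>lebesgue)
    \<le> ennreal_powr (ennreal (max 1 (r * real (2 * m) ^ m))) q *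
      (ennreal_powr C q * (\<Prod>i=1..m. ennreal_powr (2 * (\<integral>\<^sup>+x. h i x \<partial>lebesgue)) (q / P i)))"
    (is "_ \<le> ?B")
proof -
  let ?N = "\<lambda>Q. \<integral>\<^sup>+x\<in>dyadic \<alpha> Q. V x \<partial>lebesgue"
  let ?g = "\<lambda>Q x. ennreal_powr (dyadic_average_prod \<phi> m f \<alpha> Q) q * indicator (dyadic \<alpha> Q) x * V x"
  let ?s = "\<lambda>Q :: int \<times> (int^'n). dyadic_side Q ^ CARD('n)"
  \<comment> \<open>On cubes without mass the left side of the test condition is 0 and gives no
    control of \<open>\<omega>\<close>. Those cubes are set aside and return at the end with zero
    contribution.\<close>
  define D where "D = {Q. ?N Q \<noteq> 0}"
  define \<beta> where "\<beta> i Q = bfs_average (associate_norm (Y i)) (dyadic_corner \<alpha> Q) (dyadic_side Q) (\<lambda>x. f i x * w i x)" for i Q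
  define \<omega> where "\<omega> i Q = bfs_average (Y i) (dyadic_corner \<alpha> Q) (dyadic_side Q) (\<lambda>x. inverse (w i x))" for i Q
  have testQ: "ennreal (\<phi> (?s Q) * ?s Q powr (1/q - 1/p)) * ennreal_powr (ennreal (1 / ?s Q) * ?N Q) (1/q) * (\<Prod>i=1..m. \<omega> i Q) \<le> C" for Q
    using test[OF dyadic_side_pos, of "dyadic_corner \<alpha> Q" Q]
    by (simp only: measure_cube[OF dyadic_side_pos] nn_integral_cube_eq_dyadic \<omega>_def)
  have \<omega>_fin: "\<omega> i Q < top" if "Q \<in> D" "i \<in> {1..m}" for i Q
  proof -
    \<comment> \<open>With every factor of the test condition nonzero, one infinite
      \<open>\<omega> i Q\<close> would make its left side infinite.\<close>
    have nz: "\<omega> i Q \<noteq> 0" if "i \<in> {1..m}" for i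
      unfolding \<omega>_def using Y[OF that] w[OF that] w_pos[OF that]
      by (intro bfs_average_nonzero) (auto elim: eventually_mono)
    have a: "ennreal (\<phi> (?s Q) * ?s Q powr (1/q - 1/p)) \<noteq> 0" (is "?a \<noteq> 0")
      using \<phi>_pos[of "?s Q"] by (simp add: ennreal_eq_0_iff not_le mult_pos_pos)
    have b: "ennreal_powr (ennreal (1 / ?s Q) * ?N Q) (1/q) \<noteq> 0" (is "?b \<noteq> 0")
      using \<open>Q \<in> D\<close> by (simp add: D_def ennreal_eq_0_iff not_le)
    show ?thesis
    proof (rule ccontr)
      assume "\<not> \<omega> i Q < top"
      then have "\<omega> i Q = top" using less_top by blast
      then have "(\<Prod>i=1..m. \<omega> i Q) = top"
        using nz \<open>i \<in> {1..m}\<close> by (subst ennreal_prod_eq_top) auto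
      then have "?a * ?b * (\<Prod>i=1..m. \<omega> i Q) = top"
        using a b by (simp only: ennreal_mult_top mult_eq_0_iff simp_thms if_False)
      then show False using testQ[of Q] C by (simp add: top_unique)
    qed
  qed
  have \<beta>_fin: "\<beta> i Q < top" if "i \<in> {1..m}" for i Q
    unfolding \<beta>_def using P[OF that] h[OF that] by (intro bfs_average_finite) (simp add: h_def)+
  have avg: "ennreal (1 / ?s Q) * (\<integral>\<^sup>+y\<in>dyadic \<alpha> Q. ennreal \<bar>f i y\<bar> \<partial>lebesgue) \<le> \<beta> i Q * \<omega> i Q"
    if "Q \<in> D" "i \<in> {1..m}" for i Q
    unfolding \<beta>_def \<omega>_def using \<omega>_fin[OF that] Y f w w_pos that
    by (intro dyadic_average_le) (auto simp: \<omega>_def)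
  have "(\<integral>\<^sup>+x. (SUP Q\<in>D. ?g Q x) \<partial>lebesgue) \<le> ?B"
  proof (rule nn_integral_SUP_countable_le)
    fix F assume F: "finite F" "F \<subseteq> D"
    show "(\<integral>\<^sup>+x. (SUP Q\<in>F. ?g Q x) \<partial>lebesgue) \<le> ?B"
    proof (rule finite_dyadic_maximal_estimate[where c = "\<lambda>i Q. ennreal_powr (\<beta> i Q) (P i)"])
      fix i Q assume i: "i \<in> {1..m}" and Q: "Q \<in> F"
      have QD: "Q \<in> D" using Q F by auto
      have "\<beta> i Q * \<omega> i Q < top"
        using \<omega>_fin[OF QD i] \<beta>_fin[OF i] by (simp add: ennreal_mult_less_top)
      with avg[OF QD i] have "ennreal (1 / ?s Q) * (\<integral>\<^sup>+y\<in>dyadic \<alpha> Q. ennreal \<bar>f i y\<bar> \<partial>lebesgue) < top"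
        by (rule le_less_trans)
      then show "(\<integral>\<^sup>+y\<in>dyadic \<alpha> Q. ennreal \<bar>f i y\<bar> \<partial>lebesgue) < top"
        by (auto simp: ennreal_mult_less_top ennreal_eq_0_iff not_le divide_le_0_iff)
    next
      fix Q assume "Q \<in> F"
      then have Q: "Q \<in> D" using F by auto
      show "ennreal_powr (dyadic_average_prod \<phi> m f \<alpha> Q) q * ?N Q
          \<le> ennreal_powr C q * (\<Prod>i=1..m. ennreal_powr (emeasure lebesgue (dyadic \<alpha> Q) * ennreal_powr (\<beta> i Q) (P i)) (q / P i))"
        unfolding emeasure_dyadic
      proof (rule test_condition_imp[OF _ q(1) P p _ _ testQ])
        show "dyadic_average_prod \<phi> m f \<alpha> Q \<le> ennreal (\<phi> (?s Q)) * (\<Prod>i=1..m. \<beta> i Q * \<omega> i Q)"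
          unfolding dyadic_average_prod_def using Q by (intro mult_left_mono prod_mono_ennreal avg) auto
      qed (auto intro!: \<phi>_pos)
    next
      fix i Q x assume "i \<in> {1..m}" "x \<in> dyadic \<alpha> Q"
      then show "ennreal_powr (\<beta> i Q) (P i) \<le> h i x"
        using P[of i] unfolding h_def \<beta>_def by (intro ennreal_powr_mono bfs_average_le_maximal) auto
    qed (use \<phi> r m P q F f V in auto)
  qed measurable
  moreover have "(\<integral>\<^sup>+x. (SUP Q. ?g Q x) \<partial>lebesgue) \<le> (\<integral>\<^sup>+x. (SUP Q\<in>D. ?g Q x) \<partial>lebesgue)"
  proof (rule nn_integral_mono_AE)
    \<comment> \<open>The dyadic cubes of a grid are countably many, so a single null set will serve
      all cubes outside \<open>D\<close>.\<close>
    have "AE x in lebesgue. Q \<in> D \<or> V x * indicator (dyadic \<alpha> Q) x = 0" for Q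
    proof (cases "Q \<in> D")
      case False
      then have "?N Q = 0" by (simp add: D_def)
      then have "AE x in lebesgue. V x * indicator (dyadic \<alpha> Q) x = 0"
        by (subst (asm) nn_integral_0_iff_AE) auto
      then show ?thesis by eventually_elim simp
    qed simp
    then have "AE x in lebesgue. \<forall>Q. Q \<in> D \<or> V x * indicator (dyadic \<alpha> Q) x = 0"
      by (simp only: AE_all_countable) blast
    then show "AE x in lebesgue. (SUP Q. ?g Q x) \<le> (SUP Q\<in>D. ?g Q x)"
    proof eventually_elim
      case (elim x)
      show ?case
      proof (rule SUP_least)
        fix Q
        show "?g Q x \<le> (SUP Q\<in>D. ?g Q x)"
        proof (cases "Q \<in> D")
          case True
          then show ?thesis by (rule SUP_upper)
        next
          case False
          with elim have "V x * indicator (dyadic \<alpha> Q) x = 0" by blast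
          then have "?g Q x = 0" by auto
          then show ?thesis by (simp only: zero_le)
        qed
      qed
    qed
  qed
  ultimately show ?thesis by (rule order_trans[rotated])
qed

section \<open>Summation over the grids and the norm inequality\<close>

lemma Lp_norm_powr:
  "ennreal_powr (Lp_norm p g) s = ennreal_powr (\<integral>\<^sup>+x. ennreal_powr (g x) p \<partial>lebesgue) (s / p)"
  by (simp add: Lp_norm_def ennreal_powr_powr)

theorem theorem5p2:
  fixes m :: nat
    and P :: "nat \<Rightarrow> real"
    and p q :: real
    and \<phi> :: "real \<Rightarrow> real"
    and Y :: "nat \<Rightarrow> (real^'n \<Rightarrow> ennreal) \<Rightarrow> ennreal"
    and \<nu> :: "real^'n \<Rightarrow> real"
    and w :: "nat \<Rightarrow> real^'n \<Rightarrow> real"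
  assumes "m \<ge> 1"
    and "\<And>i. i \<in> {1..m} \<Longrightarrow> 1 < P i"
    and "1 / p = (\<Sum>i=1..m. 1 / P i)"
    and "1 / real m < p" and "p \<le> q"
    and "\<And>t. 0 < t \<Longrightarrow> 0 < \<phi> t"
    and "essentially_nondecreasing \<phi>"
    and "((\<lambda>t. \<phi> t / t) \<longlongrightarrow> 0) at_top"
    and "\<And>i. i \<in> {1..m} \<Longrightarrow> banach_function_norm (Y i)"
    and "\<And>i. i \<in> {1..m} \<Longrightarrow> bounded_on_Lp (P i) (bfs_maximal (associate_norm (Y i)))"
    and "weight \<nu>"
    and "\<And>i. i \<in> {1..m} \<Longrightarrow> weight (w i)"
    and "\<And>i. i \<in> {1..m} \<Longrightarrow> AE x in lebesgue. 0 < w i x"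
    and "\<exists>C::real>0. \<forall>a l. 0 < l \<longrightarrow>
           ennreal (\<phi> (measure lebesgue (cube a l)) * measure lebesgue (cube a l) powr (1/q - 1/p)) *
           ennreal_powr (ennreal (1 / measure lebesgue (cube a l)) *
                         (\<integral>\<^sup>+x\<in>cube a l. ennreal (\<nu> x powr q) \<partial>lebesgue)) (1/q) *
           (\<Prod>i=1..m. bfs_average (Y i) a l (\<lambda>x. inverse (w i x))) \<le> ennreal C"
  shows "\<exists>C::real>0. \<forall>f :: nat \<Rightarrow> real^'n \<Rightarrow> real.
           (\<forall>i\<in>{1..m}. f i \<in> Lp_space (P i) (\<lambda>x. w i x powr P i)) \<longrightarrow>
           Lp_norm q (\<lambda>x. multilinear_maximal \<phi> m f x * ennreal (\<nu> x)) \<le>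
             ennreal C * (\<Prod>i=1..m. Lp_norm (P i) (\<lambda>x. ennreal \<bar>f i x * w i x\<bar>))"
proof -
  have "0 < p" using assms(4) by (rule le_less_trans[rotated]) simp
  then have q: "0 < q" using assms(5) by simp
  have P: "0 < P i" if "i \<in> {1..m}" for i using assms(2)[OF that] by simp
  \<comment> \<open>This is where \<open>p \<le> q\<close> enters: the exponents of the discrete
    Hoelder inequality sum to q/p.\<close>
  have "(\<Sum>i=1..m. q / P i) = q * (1 / p)"
    unfolding assms(3) by (simp add: sum_distrib_left)
  then have q_ge: "1 \<le> (\<Sum>i=1..m. q / P i)" using assms(5) \<open>0 < p\<close> by simp
  obtain r where r: "0 < r" and \<phi>: "\<And>t s. 0 < t \<Longrightarrow> t \<le> s \<Longrightarrow> \<phi> t \<le> r * \<phi> s"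
    using assms(7) unfolding essentially_nondecreasing_def by blast
  obtain C0 :: real where test: "\<And>a l. 0 < l \<Longrightarrow>
           ennreal (\<phi> (measure lebesgue (cube a l)) * measure lebesgue (cube a l) powr (1/q - 1/p)) *
           ennreal_powr (ennreal (1 / measure lebesgue (cube a l)) *
                         (\<integral>\<^sup>+x\<in>cube a l. ennreal (\<nu> x powr q) \<partial>lebesgue)) (1/q) *
           (\<Prod>i=1..m. bfs_average (Y i) a l (\<lambda>x. inverse (w i x))) \<le> ennreal C0"
    using assms(14) by blast
  have "\<forall>i\<in>{1..m}. \<exists>D::real. \<forall>g\<in>Lp_space (P i) (\<lambda>_. 1).
      Lp_norm (P i) (bfs_maximal (associate_norm (Y i)) g) \<le> ennreal D * Lp_norm (P i) (\<lambda>x. ennreal \<bar>g x\<bar>)"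
    using assms(10) unfolding bounded_on_Lp_def by blast
  then obtain D :: "nat \<Rightarrow> real" where D: "\<And>i g. i \<in> {1..m} \<Longrightarrow> g \<in> Lp_space (P i) (\<lambda>_. 1) \<Longrightarrow>
      Lp_norm (P i) (bfs_maximal (associate_norm (Y i)) g) \<le> ennreal (D i) * Lp_norm (P i) (\<lambda>x. ennreal \<bar>g x\<bar>)"
    by (subst (asm) bchoice_iff) blast
  have w [measurable]: "w i \<in> borel_measurable lebesgue" and w0: "0 \<le> w i x" if "i \<in> {1..m}" for i x
    using assms(12)[OF that] by (auto simp: weight_def)
  have \<nu> [measurable]: "\<nu> \<in> borel_measurable lebesgue" and \<nu>0: "\<And>x. 0 \<le> \<nu> x"
    using assms(11) by (auto simp: weight_def)
  define V where "V x = ennreal (\<nu> x powr q)" for x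
  have V [measurable]: "V \<in> borel_measurable lebesgue" unfolding V_def by measurable
  \<comment> \<open>The constant is fixed before \<open>f\<close>. \<open>A\<close> comes from the
    selection of principal cubes, \<open>B\<close> from passing to dyadic cubes, \<open>E\<close>
    from sparseness and the bounds of the maximal operators; \<open>K\<close> also counts the grids,
    one for each set of shifted coordinates.\<close>
  define A where "A = ennreal_powr (ennreal (max 1 (r * real (2 * m) ^ m))) q"
  define B where "B = ennreal_powr (ennreal (r * (6 ^ CARD('n)) ^ m)) q"
  define E where "E = (\<Prod>i=1..m. ennreal_powr 2 (q / P i) * ennreal_powr (ennreal (D i)) q)"
  define K1 where "K1 = A * (ennreal_powr (ennreal C0) q * E)"
  define K where "K = ennreal_powr (B * (of_nat (card (UNIV :: 'n set set)) * K1)) (1 / q)"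
  have "A < top" "B < top" by (simp_all add: A_def B_def)
  moreover have "E \<noteq> top" by (auto simp: E_def ennreal_prod_eq_top ennreal_mult_eq_top_iff)
  ultimately have "K1 < top" by (simp add: K1_def ennreal_mult_eq_top_iff less_top[symmetric])
  with \<open>B < top\<close> have "K < top"
    by (simp only: K_def ennreal_powr_less_top_iff ennreal_mult_less_top of_nat_less_top) simp
  show ?thesis
  proof (intro exI[of _ "enn2real K + 1"] conjI allI impI)
    show "0 < enn2real K + 1" by (simp add: add_nonneg_pos)
    fix f :: "nat \<Rightarrow> real^'n \<Rightarrow> real"
    assume "\<forall>i\<in>{1..m}. f i \<in> Lp_space (P i) (\<lambda>x. w i x powr P i)"
    then have f [measurable]: "f i \<in> borel_measurable lebesgue"
      and fL: "(\<integral>\<^sup>+x. ennreal (\<bar>f i x\<bar> powr P i * w i x powr P i) \<partial>lebesgue) < top" if "i \<in> {1..m}" for i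
      using that by (auto simp: Lp_space_def)
    define N where "N i = Lp_norm (P i) (\<lambda>x. ennreal \<bar>f i x * w i x\<bar>)" for i
    define h where "h i x = ennreal_powr (bfs_maximal (associate_norm (Y i)) (\<lambda>x. f i x * w i x) x) (P i)" for i x
    \<comment> \<open>Membership of \<open>f i\<close> in the weighted space says that
      \<open>f i * w i\<close> lies in the unweighted one, where the maximal operator is
      bounded.\<close>
    have fw: "(\<lambda>x. f i x * w i x) \<in> Lp_space (P i) (\<lambda>_. 1)" and N_fin: "N i < top" if i: "i \<in> {1..m}" for i
    proof -
      note [measurable] = f[OF i] w[OF i]
      have eq: "\<bar>f i x * w i x\<bar> powr P i = \<bar>f i x\<bar> powr P i * w i x powr P i" for x
        using w0[OF i] by (simp add: abs_mult powr_mult)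
      show "(\<lambda>x. f i x * w i x) \<in> Lp_space (P i) (\<lambda>_. 1)"
        using fL[OF i] by (simp add: Lp_space_def eq)
      show "N i < top"
        using fL[OF i] by (simp add: N_def Lp_norm_def ennreal_powr_ennreal eq)
    qed
    \<comment> \<open>Boundedness of the maximal operator raised to the power \<open>s\<close>: the
      value 1 yields finiteness, the value \<open>q\<close> the final estimate.\<close>
    have hN: "ennreal_powr (\<integral>\<^sup>+x. h i x \<partial>lebesgue) (s / P i) \<le> ennreal_powr (ennreal (D i) * N i) s"
      if "i \<in> {1..m}" "0 < s" for i s
      using ennreal_powr_mono[OF _ D[OF that(1) fw[OF that(1)]], of s] P[OF that(1)] that(2)
      by (simp add: Lp_norm_powr h_def N_def)
    have h_fin: "(\<integral>\<^sup>+x. h i x \<partial>lebesgue) < top" if "i \<in> {1..m}" for i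
    proof -
      have "ennreal_powr (\<integral>\<^sup>+x. h i x \<partial>lebesgue) (1 / P i) < top"
        using N_fin[OF that] by (intro le_less_trans[OF hN[OF that zero_less_one]]) (simp add: ennreal_mult_less_top)
      then show ?thesis by simp
    qed
    let ?S = "\<lambda>\<alpha> x. SUP Q. ennreal_powr (dyadic_average_prod \<phi> m f \<alpha> Q) q * indicator (dyadic \<alpha> Q) x * V x"
    have S: "(\<integral>\<^sup>+x. ?S \<alpha> x \<partial>lebesgue) \<le> K1 * (\<Prod>i=1..m. ennreal_powr (N i) q)" for \<alpha>
    proof -
      have "(\<integral>\<^sup>+x. ?S \<alpha> x \<partial>lebesgue) \<le> A * (ennreal_powr (ennreal C0) q * (\<Prod>i=1..m. ennreal_powr (2 * (\<integral>\<^sup>+x. h i x \<partial>lebesgue)) (q / P i)))"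
        unfolding A_def
        by (rule dyadic_maximal_estimate[OF \<phi> r assms(6) assms(1) P q q_ge assms(3) assms(9) f w assms(13) V])
           (use test h_fin in \<open>auto simp: h_def V_def\<close>)
      also have "\<dots> \<le> A * (ennreal_powr (ennreal C0) q *
          (\<Prod>i=1..m. ennreal_powr 2 (q / P i) * ennreal_powr (ennreal (D i) * N i) q))"
        using hN q by (intro mult_left_mono prod_mono_ennreal) (auto simp: ennreal_powr_mult[of 2] intro!: mult_left_mono)
      also have "\<dots> = K1 * (\<Prod>i=1..m. ennreal_powr (N i) q)"
        by (simp add: K1_def E_def ennreal_powr_mult prod.distrib ac_simps)
      finally show ?thesis .
    qed
    have pointwise: "ennreal_powr (multilinear_maximal \<phi> m f x * ennreal (\<nu> x)) q \<le> B * (\<Sum>\<alpha>\<in>UNIV. ?S \<alpha> x)" for x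
    proof -
      \<comment> \<open>The maximum over the finitely many grids is replaced by a sum of
        \<open>q\<close>-th powers, which can be integrated term by term.\<close>
      let ?T = "\<lambda>\<alpha>. SUP Q. ennreal_powr (dyadic_average_prod \<phi> m f \<alpha> Q) q * indicator (dyadic \<alpha> Q) x"
      have "multilinear_maximal \<phi> m f x
          \<le> ennreal (r * (6 ^ CARD('n)) ^ m) * ennreal_powr (\<Sum>\<alpha>\<in>UNIV. ?T \<alpha>) (1 / q)"
      proof (rule multilinear_maximal_le[OF \<phi> r])
        fix \<alpha> Q assume x: "x \<in> dyadic \<alpha> Q"
        have "ennreal_powr (dyadic_average_prod \<phi> m f \<alpha> Q) q \<le> ?T \<alpha>"
          using x by (intro SUP_upper2[of Q]) auto
        also have "\<dots> \<le> (\<Sum>\<alpha>\<in>UNIV. ?T \<alpha>)" by (intro member_le_sum) auto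
        finally show "dyadic_average_prod \<phi> m f \<alpha> Q \<le> ennreal_powr (\<Sum>\<alpha>\<in>UNIV. ?T \<alpha>) (1 / q)"
          by (rule ennreal_powr_le_imp[OF q])
      qed
      then have "ennreal_powr (multilinear_maximal \<phi> m f x) q \<le> B * (\<Sum>\<alpha>\<in>UNIV. ?T \<alpha>)"
        using ennreal_powr_mono[of q] q unfolding B_def
        by (fastforce simp: ennreal_powr_mult ennreal_powr_powr)
      then have "ennreal_powr (multilinear_maximal \<phi> m f x) q * V x \<le> B * (\<Sum>\<alpha>\<in>UNIV. ?T \<alpha>) * V x"
        by (rule mult_right_mono) simp
      also have "\<dots> = B * (\<Sum>\<alpha>\<in>UNIV. ?S \<alpha> x)"
        by (simp add: SUP_mult_right_ennreal sum_distrib_right mult.assoc)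
      finally show ?thesis
        using \<nu>0 by (simp add: ennreal_powr_mult ennreal_powr_ennreal V_def)
    qed
    have Sm: "?S \<alpha> \<in> borel_measurable lebesgue" for \<alpha>
      by (intro borel_measurable_SUP) auto
    \<comment> \<open>Monotonicity of \<open>nn_integral\<close> holds for arbitrary functions. From
      here on only the majorant is split up, a countable supremum of measurable functions for each
      grid.\<close>
    have "(\<integral>\<^sup>+x. ennreal_powr (multilinear_maximal \<phi> m f x * ennreal (\<nu> x)) q \<partial>lebesgue)
        \<le> (\<integral>\<^sup>+x. B * (\<Sum>\<alpha>\<in>UNIV. ?S \<alpha> x) \<partial>lebesgue)"
      using pointwise by (rule nn_integral_mono)
    also have "\<dots> = B * (\<Sum>\<alpha>\<in>UNIV. \<integral>\<^sup>+x. ?S \<alpha> x \<partial>lebesgue)"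
      using Sm by (simp add: nn_integral_cmult nn_integral_sum)
    also have "\<dots> \<le> B * (\<Sum>\<alpha>\<in>(UNIV :: 'n set set). K1 * (\<Prod>i=1..m. ennreal_powr (N i) q))"
      using S by (intro mult_left_mono sum_mono) auto
    also have "\<dots> = B * (of_nat (card (UNIV :: 'n set set)) * K1) * ennreal_powr (\<Prod>i=1..m. N i) q"
      by (simp add: ennreal_powr_prod mult.assoc)
    finally have "Lp_norm q (\<lambda>x. multilinear_maximal \<phi> m f x * ennreal (\<nu> x))
        \<le> ennreal_powr (B * (of_nat (card (UNIV :: 'n set set)) * K1) * ennreal_powr (\<Prod>i=1..m. N i) q) (1 / q)"
      unfolding Lp_norm_def using q by (intro ennreal_powr_mono) auto
    also have "\<dots> = K * (\<Prod>i=1..m. N i)"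
      unfolding K_def using q by (simp only: ennreal_powr_mult ennreal_powr_powr) simp
    also have "\<dots> \<le> ennreal (enn2real K + 1) * (\<Prod>i=1..m. N i)"
    proof (rule mult_right_mono)
      have "K = ennreal (enn2real K)" using \<open>K < top\<close> by simp
      also have "\<dots> \<le> ennreal (enn2real K + 1)" by (intro ennreal_leI) simp
      finally show "K \<le> ennreal (enn2real K + 1)" .
    qed simp
    finally show "Lp_norm q (\<lambda>x. multilinear_maximal \<phi> m f x * ennreal (\<nu> x))
        \<le> ennreal (enn2real K + 1) * (\<Prod>i=1..m. Lp_norm (P i) (\<lambda>x. ennreal \<bar>f i x * w i x\<bar>))"
      by (simp only: N_def)
  qed
qed

end
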